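(* For item values that are independently and uniformly distributed on continuous intervals, Problem (SP) can be solved in time $\mathcal{O}(n^4A)$.
   Context: Problem (SP), the stochastic bilevel continuous knapsack problem, is: maximize $\mathbb{E}_{\mathbf{c}}(d^\top x^{\mathbf{c}} - \delta b)$ over $b \in [b^-, b^+]$, where for each realization $c$ of the random vector $\mathbf{c}$ the follower's solution $x^{c}$ is an optimal solution of $\max\{c^\top x : a^\top x \le b,\ x \in [0,1]^n\}$. Here $a \in \mathbb{N}^n$ with $a>0$ are item sizes, $d \in \mathbb{Z}^n$ are the leader's item values, $\delta \ge 0$, and $0 \le b^- \le b^+ \le A := \sum_{i=1}^n a_i$. The components $\mathbf{c}_i$ are independent, and $\mathbf{c}_i$ is uniformly distributed on an interval $[c_i^-, c_i^+]$ with $c_i^- < c_i^+$. *)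

theory Defs
  imports "HOL-Probability.Probability"
begin

section \<open>The stochastic bilevel continuous knapsack problem\<close>

text \<open>
  Vectors indexed by \<open>1, \<dots>, n\<close> are functions on \<^typ>\<open>nat\<close> of which only the values at indices below
  \<open>items I\<close> are relevant.
\<close>

record instance_SP =
  items :: nat                      \<comment> \<open>\<open>n\<close>\<close>
  item_size :: "nat \<Rightarrow> nat"         \<comment> \<open>\<open>a\<close>\<close>
  leader_value :: "nat \<Rightarrow> int"      \<comment> \<open>\<open>d\<close>\<close>
  c_lower :: "nat \<Rightarrow> real"          \<comment> \<open>\<open>c\<^sup>-\<close>\<close>
  c_upper :: "nat \<Rightarrow> real"          \<comment> \<open>\<open>c\<^sup>+\<close>\<close>
  unit_price :: real                \<comment> \<open>\<open>\<delta>\<close>\<close>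
  b_lower :: real                   \<comment> \<open>\<open>b\<^sup>-\<close>\<close>
  b_upper :: real                   \<comment> \<open>\<open>b\<^sup>+\<close>\<close>

definition total_size :: "instance_SP \<Rightarrow> nat" where
  "total_size I = (\<Sum>i<items I. item_size I i)"

definition valid_instance :: "instance_SP \<Rightarrow> bool" where
  "valid_instance I \<longleftrightarrow>
     0 < items I \<and>
     (\<forall>i<items I. 0 < item_size I i) \<and>
     (\<forall>i<items I. c_lower I i < c_upper I i) \<and>
     0 \<le> unit_price I \<and>
     0 \<le> b_lower I \<and> b_lower I \<le> b_upper I \<and> b_upper I \<le> real (total_size I)"

definition follower_feasible :: "instance_SP \<Rightarrow> real \<Rightarrow> (nat \<Rightarrow> real) set" where
  "follower_feasible I b =
     {x. (\<forall>i<items I. 0 \<le> x i \<and> x i \<le> 1) \<and> (\<Sum>i<items I. real (item_size I i) * x i) \<le> b}"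

definition follower_optimal :: "instance_SP \<Rightarrow> real \<Rightarrow> (nat \<Rightarrow> real) \<Rightarrow> (nat \<Rightarrow> real) set" where
  "follower_optimal I b c =
     {x \<in> follower_feasible I b.
        \<forall>y \<in> follower_feasible I b. (\<Sum>i<items I. c i * y i) \<le> (\<Sum>i<items I. c i * x i)}"

text \<open>
  A choice, for every capacity and every realization, of an optimal follower's solution.  No tie
  breaking rule is imposed.
\<close>

definition follower_response :: "instance_SP \<Rightarrow> (real \<Rightarrow> (nat \<Rightarrow> real) \<Rightarrow> nat \<Rightarrow> real) \<Rightarrow> bool" where
  "follower_response I x \<longleftrightarrow>
     (\<forall>b \<in> {b_lower I..b_upper I}. \<forall>c. x b c \<in> follower_optimal I b c)"

text \<open>
  The joint law of independent item values, the \<open>i\<close>-th one uniform on \<open>[c\<^sub>i\<^sup>-, c\<^sub>i\<^sup>+]\<close>.  The optimal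
  follower's solution is unique for almost every realization, so an arbitrary
  \<^const>\<open>follower_response\<close> agrees almost everywhere with a Borel measurable one but need not be Borel
  measurable itself.  On the completed measure it is measurable, hence the expectation below is the
  intended one and not the default value of the Bochner integral.
\<close>

definition value_law :: "instance_SP \<Rightarrow> (nat \<Rightarrow> real) measure" where
  "value_law I =
     completion (\<Pi>\<^sub>M i\<in>{..<items I}. uniform_measure lborel {c_lower I i..c_upper I i})"

definition leader_objective ::
  "instance_SP \<Rightarrow> (real \<Rightarrow> (nat \<Rightarrow> real) \<Rightarrow> nat \<Rightarrow> real) \<Rightarrow> real \<Rightarrow> real" where
  "leader_objective I x b =
     (\<integral>c. (\<Sum>i<items I. real_of_int (leader_value I i) * x b c i) - unit_price I * b \<partial>value_law I)"

definition optimal_solution_SP :: "instance_SP \<Rightarrow> real \<Rightarrow> real \<Rightarrow> bool" where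
  "optimal_solution_SP I b v \<longleftrightarrow>
     b \<in> {b_lower I..b_upper I} \<and>
     (\<forall>x. follower_response I x \<longrightarrow>
        leader_objective I x b = v \<and>
        (\<forall>b' \<in> {b_lower I..b_upper I}. leader_objective I x b' \<le> leader_objective I x b))"

lemma follower_optimal_nonempty:
  assumes "0 \<le> b"
  shows "follower_optimal I b c \<noteq> {}"
proof -
  define n where "n = items I"
  define box where "box = PiE UNIV (\<lambda>_::nat. {0..1::real})"
  define w where "w = (\<lambda>x. \<Sum>i<n. real (item_size I i) * x i)"
  define g where "g = (\<lambda>x. \<Sum>i<n. c i * x i)"
  define K where "K = box \<inter> {x. w x \<le> b}"
  have feas: "x \<in> follower_feasible I b \<longleftrightarrow> (\<forall>i<n. 0 \<le> x i \<and> x i \<le> 1) \<and> w x \<le> b" for x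
    by (simp add: follower_feasible_def n_def w_def)
  have K: "x \<in> K \<longleftrightarrow> (\<forall>i. 0 \<le> x i \<and> x i \<le> 1) \<and> w x \<le> b" for x
    by (simp add: K_def box_def PiE_iff)
  have cont_w: "continuous_on UNIV w" and cont_g: "continuous_on UNIV g"
    unfolding w_def g_def
    by (intro continuous_on_sum continuous_on_mult continuous_on_const
        continuous_on_product_coordinates)+
  have "compactin (product_topology (\<lambda>_. euclidean) UNIV) box"
    unfolding box_def compactin_PiE by simp
  then have "compact box"
    by (simp add: euclidean_product_topology)
  moreover have "closed {x. w x \<le> b}"
    by (rule closed_Collect_le[OF cont_w continuous_on_const])
  ultimately have "compact K"
    unfolding K_def by (rule compact_Int_closed)
  moreover have "(\<lambda>_. 0) \<in> K"
    using assms by (simp add: K w_def)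
  then have "K \<noteq> {}"
    by (rule ex_in_conv[THEN iffD1, OF exI])
  moreover have "continuous_on K g"
    by (rule continuous_on_subset[OF cont_g subset_UNIV])
  ultimately obtain x where x: "x \<in> K" "\<forall>y\<in>K. g y \<le> g x"
    using continuous_attains_sup[of K g] by auto
  have "g y \<le> g x" if y: "y \<in> follower_feasible I b" for y
  proof -
    define z where "z = (\<lambda>i. if i < n then y i else 0)"
    have "w z = w y" and g: "g z = g y"
      unfolding w_def g_def z_def by simp_all
    then have "z \<in> K"
      using y by (simp add: K feas z_def)
    with x(2) g show ?thesis
      by force
  qed
  moreover have "x \<in> follower_feasible I b"
    using x(1) by (simp add: K feas)
  ultimately have "x \<in> follower_optimal I b c"
    by (simp add: follower_optimal_def g_def n_def)
  then show ?thesis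
    by (rule ex_in_conv[THEN iffD1, OF exI])
qed

lemma follower_response_exists:
  assumes "valid_instance I"
  shows "\<exists>x. follower_response I x"
proof -
  have "(SOME y. y \<in> follower_optimal I b c) \<in> follower_optimal I b c"
    if "b \<in> {b_lower I..b_upper I}" for b c
  proof -
    have "0 \<le> b"
      using assms that unfolding valid_instance_def by simp
    from follower_optimal_nonempty[OF this, of I c] show ?thesis
      by (rule some_in_eq[THEN iffD2])
  qed
  then show ?thesis
    unfolding follower_response_def
    by (intro exI[of _ "\<lambda>b c. SOME y. y \<in> follower_optimal I b c"] ballI allI)
qed

section \<open>Running time: random access programs under the uniform cost measure\<close>

text \<open>
  A random access machine with integer and real cells, written as a structured language.  Cells are
  addressed by an array name and a computed integer index; a program mentions only finitely many
  names.  Integers and reals admit exact arithmetic and comparisons at unit cost.  There is no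
  rounding from reals to integers, no integer division, and all constants are integers.
\<close>

datatype iexp =
    IConst int
  | ICell string iexp
  | IAdd iexp iexp
  | ISub iexp iexp
  | IMul iexp iexp

datatype rexp =
    ROfInt iexp
  | RCell string iexp
  | RAdd rexp rexp
  | RSub rexp rexp
  | RMul rexp rexp
  | RDiv rexp rexp

datatype bexp =
    ILe iexp iexp
  | RLe rexp rexp
  | BNot bexp
  | BAnd bexp bexp

datatype com =
    Skip
  | IAssign string iexp iexp    \<comment> \<open>array name, index, new content\<close>
  | RAssign string iexp rexp
  | Seq com com
  | Cond bexp com com
  | While bexp com

record memory =
  icells :: "string \<Rightarrow> int \<Rightarrow> int"
  rcells :: "string \<Rightarrow> int \<Rightarrow> real"

primrec ival :: "iexp \<Rightarrow> memory \<Rightarrow> int" where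
  "ival (IConst k) s = k"
| "ival (ICell X e) s = icells s X (ival e s)"
| "ival (IAdd e f) s = ival e s + ival f s"
| "ival (ISub e f) s = ival e s - ival f s"
| "ival (IMul e f) s = ival e s * ival f s"

primrec rval :: "rexp \<Rightarrow> memory \<Rightarrow> real" where
  "rval (ROfInt e) s = real_of_int (ival e s)"
| "rval (RCell X e) s = rcells s X (ival e s)"
| "rval (RAdd e f) s = rval e s + rval f s"
| "rval (RSub e f) s = rval e s - rval f s"
| "rval (RMul e f) s = rval e s * rval f s"
| "rval (RDiv e f) s = rval e s / rval f s"

primrec bval :: "bexp \<Rightarrow> memory \<Rightarrow> bool" where
  "bval (ILe e f) s \<longleftrightarrow> ival e s \<le> ival f s"
| "bval (RLe e f) s \<longleftrightarrow> rval e s \<le> rval f s"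
| "bval (BNot p) s \<longleftrightarrow> \<not> bval p s"
| "bval (BAnd p q) s \<longleftrightarrow> bval p s \<and> bval q s"

text \<open>Every constant, cell access, operation and comparison counts as one step.\<close>

primrec icost :: "iexp \<Rightarrow> nat" where
  "icost (IConst k) = 1"
| "icost (ICell X e) = icost e + 1"
| "icost (IAdd e f) = icost e + icost f + 1"
| "icost (ISub e f) = icost e + icost f + 1"
| "icost (IMul e f) = icost e + icost f + 1"

primrec rcost :: "rexp \<Rightarrow> nat" where
  "rcost (ROfInt e) = icost e + 1"
| "rcost (RCell X e) = icost e + 1"
| "rcost (RAdd e f) = rcost e + rcost f + 1"
| "rcost (RSub e f) = rcost e + rcost f + 1"
| "rcost (RMul e f) = rcost e + rcost f + 1"
| "rcost (RDiv e f) = rcost e + rcost f + 1"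

primrec bcost :: "bexp \<Rightarrow> nat" where
  "bcost (ILe e f) = icost e + icost f + 1"
| "bcost (RLe e f) = rcost e + rcost f + 1"
| "bcost (BNot p) = bcost p + 1"
| "bcost (BAnd p q) = bcost p + bcost q + 1"

definition iupdate :: "string \<Rightarrow> int \<Rightarrow> int \<Rightarrow> memory \<Rightarrow> memory" where
  "iupdate X k v s = s\<lparr>icells := (icells s)(X := (icells s X)(k := v))\<rparr>"

definition rupdate :: "string \<Rightarrow> int \<Rightarrow> real \<Rightarrow> memory \<Rightarrow> memory" where
  "rupdate X k v s = s\<lparr>rcells := (rcells s)(X := (rcells s X)(k := v))\<rparr>"

text \<open>\<open>exec p s t s'\<close>: started in memory \<open>s\<close>, program \<open>p\<close> halts after \<open>t\<close> steps in memory \<open>s'\<close>.\<close>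

inductive exec :: "com \<Rightarrow> memory \<Rightarrow> nat \<Rightarrow> memory \<Rightarrow> bool" where
  exec_Skip: "exec Skip s 1 s"
| exec_IAssign:
    "exec (IAssign X e f) s (icost e + icost f + 1) (iupdate X (ival e s) (ival f s) s)"
| exec_RAssign:
    "exec (RAssign X e f) s (icost e + rcost f + 1) (rupdate X (ival e s) (rval f s) s)"
| exec_Seq: "exec p s t s' \<Longrightarrow> exec q s' t' s'' \<Longrightarrow> exec (Seq p q) s (t + t') s''"
| exec_CondTrue: "bval e s \<Longrightarrow> exec p s t s' \<Longrightarrow> exec (Cond e p q) s (bcost e + 1 + t) s'"
| exec_CondFalse: "\<not> bval e s \<Longrightarrow> exec q s t s' \<Longrightarrow> exec (Cond e p q) s (bcost e + 1 + t) s'"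
| exec_WhileFalse: "\<not> bval e s \<Longrightarrow> exec (While e p) s (bcost e + 1) s"
| exec_WhileTrue:
    "bval e s \<Longrightarrow> exec p s t s' \<Longrightarrow> exec (While e p) s' t' s'' \<Longrightarrow>
     exec (While e p) s (bcost e + 1 + t + t') s''"

lemma exec_deterministic:
  "exec p s t s' \<Longrightarrow> exec p s u s'' \<Longrightarrow> t = u \<and> s' = s''"
proof (induction arbitrary: u s'' rule: exec.induct)
  case (exec_Skip s)
  then show ?case by cases auto
next
  case (exec_IAssign X e f s)
  then show ?case by cases auto
next
  case (exec_RAssign X e f s)
  then show ?case by cases auto
next
  case (exec_Seq p s t s' q t' s2)
  from exec_Seq.prems show ?case
    by cases (use exec_Seq.IH in blast)
next
  case (exec_CondTrue e s p t s' q)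
  from exec_CondTrue.prems show ?case
    by cases (use exec_CondTrue.hyps exec_CondTrue.IH in blast)+
next
  case (exec_CondFalse e s q t s' p)
  from exec_CondFalse.prems show ?case
    by cases (use exec_CondFalse.hyps exec_CondFalse.IH in blast)+
next
  case (exec_WhileFalse e s p)
  from exec_WhileFalse.prems show ?case
    by cases (use exec_WhileFalse.hyps in blast)+
next
  case (exec_WhileTrue e s p t s' t' s2)
  from exec_WhileTrue.prems show ?case
    by cases (use exec_WhileTrue.hyps exec_WhileTrue.IH in blast)+
qed

text \<open>Cells that hold no input are \<open>0\<close>, so the memory carries no information beyond the instance.\<close>

definition input_vector :: "nat \<Rightarrow> (nat \<Rightarrow> 'a::zero) \<Rightarrow> int \<Rightarrow> 'a" where
  "input_vector n v k = (if 0 \<le> k \<and> k < int n then v (nat k) else 0)"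

definition input_scalar :: "'a::zero \<Rightarrow> int \<Rightarrow> 'a" where
  "input_scalar y k = (if k = 0 then y else 0)"

definition input_memory :: "instance_SP \<Rightarrow> memory" where
  "input_memory I =
     \<lparr>icells = (\<lambda>_ _. 0)
        (''n'' := input_scalar (int (items I)),
         ''a'' := input_vector (items I) (\<lambda>i. int (item_size I i)),
         ''d'' := input_vector (items I) (leader_value I)),
      rcells = (\<lambda>_ _. 0)
        (''c_lower'' := input_vector (items I) (c_lower I),
         ''c_upper'' := input_vector (items I) (c_upper I),
         ''delta'' := input_scalar (unit_price I),
         ''b_lower'' := input_scalar (b_lower I),
         ''b_upper'' := input_scalar (b_upper I))\<rparr>"

text \<open>
  On every valid instance, the program halts after at most \<open>T I\<close> steps and leaves an optimal
  capacity and the optimal value in two designated cells.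
\<close>

definition solves_SP_within :: "com \<Rightarrow> (instance_SP \<Rightarrow> nat) \<Rightarrow> bool" where
  "solves_SP_within p T \<longleftrightarrow>
     (\<forall>I. valid_instance I \<longrightarrow>
        (\<exists>t s. exec p (input_memory I) t s \<and> t \<le> T I \<and>
           optimal_solution_SP I (rcells s ''b'' 0) (rcells s ''value'' 0)))"

end

theory Submission
  imports Defs
begin

text \<open>
  Almost surely the follower packs the items of positive value greedily by value per unit of size.
  The expected objective is therefore piecewise linear in the capacity with breaks at integers, and
  its slope on \<open>[w, w + 1]\<close> is the sum over the items \<open>i\<close> of \<open>d\<^sub>i / a\<^sub>i\<close> times the probability that
  \<open>i\<close> is the item being packed there, minus \<open>\<delta>\<close>.  Given that the ratio of \<open>i\<close> is \<open>t\<close>, the other items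
  precede \<open>i\<close> independently with probabilities that are linear in \<open>t\<close> between consecutive points among
  the at most \<open>2 n\<close> values \<open>c\<^sub>j\<^sup>\<plusminus> / a\<^sub>j\<close>.  On each such interval the distribution of their total size
  is polynomial in \<open>t\<close>; its coefficients are found by multiplying \<open>n\<close> sparse factors in
  \<open>O(n\<^sup>2 A)\<close> steps and are integrated exactly.  Over all \<open>O(n)\<close> intervals and \<open>n\<close> items this costs
  \<open>O(n\<^sup>4 A)\<close>.
\<close>

section \<open>Total correctness with step bounds\<close>

text \<open>Rescaling each interval to a variable \<open>v\<close> in [0, 1] makes the exact
  integration cheap: given that it lies in the interval, the ratio of \<open>i\<close> is uniform in
  \<open>v\<close>, and \<open>v^m\<close> integrates to \<open>1/(m+1)\<close>, so field operations
  suffice. The factor of \<open>i\<close> itself is free of \<open>v\<close>. Hence the degree in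
  \<open>v\<close> is at most \<open>n - 1\<close>, and \<open>n\<close> rows of
  \<open>A + 1\<close> coefficients hold the polynomial. Slopes are built from jumps. Item
  \<open>i\<close>, preceded by load \<open>L\<close>, occupies the capacities from \<open>L\<close>
  to \<open>L + a i\<close>; the indicator of this window is the partial sum of a jump +1 at
  \<open>L\<close> and a jump -1 at \<open>L + a i\<close>. Only point probabilities of loads are
  then needed, and the jumps of all items and intervals are summed up once, at the end. The breaks
  are not sorted: the next one is found by a scan, at a cost that the polynomials dominate. Items of
  negative value are never packed, so the scan starts at ratio 0. On the probabilistic side the
  obstacle is that the response is arbitrary and possibly not measurable. It is forced at every
  realization without ties, ties are null, and the completed measure does the rest.\<close>

definition runs :: "com \<Rightarrow> memory \<Rightarrow> nat \<Rightarrow> (memory \<Rightarrow> bool) \<Rightarrow> bool" where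
  "runs p s T Q \<longleftrightarrow> (\<exists>t s'. exec p s t s' \<and> t \<le> T \<and> Q s')"

text \<open>One bounded run is all that \<open>runs\<close> asks for, and \<open>exec\<close> is
  deterministic, so this is total correctness. The slack in \<open>T\<close> allows round constants
  in all later bounds.\<close>

lemma runs_weaken:
  assumes "runs p s T Q" "T \<le> T'" "\<And>s'. Q s' \<Longrightarrow> Q' s'"
  shows "runs p s T' Q'"
  using assms unfolding runs_def by (meson order_trans)

lemma runs_Skip: "Q s \<Longrightarrow> runs Skip s 1 Q"
  unfolding runs_def using exec_Skip by blast

lemma runs_IAssign:
  "Q (iupdate X (ival e s) (ival f s) s) \<Longrightarrow> runs (IAssign X e f) s (icost e + icost f + 1) Q"
  unfolding runs_def using exec_IAssign by blast

lemma runs_RAssign: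
  "Q (rupdate X (ival e s) (rval f s) s) \<Longrightarrow> runs (RAssign X e f) s (icost e + rcost f + 1) Q"
  unfolding runs_def using exec_RAssign by blast

lemma runs_Seq:
  assumes "runs p s T R" "\<And>s'. R s' \<Longrightarrow> runs q s' T' Q"
  shows "runs (Seq p q) s (T + T') Q"
  using assms unfolding runs_def by (meson add_mono exec_Seq)

lemma runs_Cond:
  assumes "bval e s \<Longrightarrow> runs p s T Q" "\<not> bval e s \<Longrightarrow> runs q s T' Q"
  shows "runs (Cond e p q) s (bcost e + 1 + max T T') Q"
proof (cases "bval e s")
  case True
  then obtain t s' where "exec p s t s'" "t \<le> T" "Q s'"
    using assms unfolding runs_def by blast
  moreover have "exec (Cond e p q) s (bcost e + 1 + t) s'"
    using True calculation by (intro exec_CondTrue)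
  ultimately show ?thesis
    unfolding runs_def by (intro exI[of _ "bcost e + 1 + t"] exI[of _ s']) auto
next
  case False
  then obtain t s' where "exec q s t s'" "t \<le> T'" "Q s'"
    using assms unfolding runs_def by blast
  moreover have "exec (Cond e p q) s (bcost e + 1 + t) s'"
    using False calculation by (intro exec_CondFalse)
  ultimately show ?thesis
    unfolding runs_def by (intro exI[of _ "bcost e + 1 + t"] exI[of _ s']) auto
qed

section \<open>Evaluation of loop-free code, frame conditions and counting loops\<close>

primrec loop_free :: "com \<Rightarrow> bool" where
  "loop_free Skip = True"
| "loop_free (IAssign X e f) = True"
| "loop_free (RAssign X e f) = True"
| "loop_free (Seq p q) = (loop_free p \<and> loop_free q)"
| "loop_free (Cond e p q) = (loop_free p \<and> loop_free q)"
| "loop_free (While e p) = False"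

text \<open>Turns a block without loops into a function that simplification can evaluate. The clause
  for \<open>While\<close> is a dummy, as it is in \<open>cost_bound\<close>; there a conditional is
  charged for both branches, which avoids a maximum.\<close>

primrec result :: "com \<Rightarrow> memory \<Rightarrow> memory" where
  "result Skip s = s"
| "result (IAssign X e f) s = iupdate X (ival e s) (ival f s) s"
| "result (RAssign X e f) s = rupdate X (ival e s) (rval f s) s"
| "result (Seq p q) s = result q (result p s)"
| "result (Cond e p q) s = (if bval e s then result p s else result q s)"
| "result (While e p) s = s"

primrec cost_bound :: "com \<Rightarrow> nat" where
  "cost_bound Skip = 1"
| "cost_bound (IAssign X e f) = icost e + icost f + 1"
| "cost_bound (RAssign X e f) = icost e + rcost f + 1"
| "cost_bound (Seq p q) = cost_bound p + cost_bound q"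
| "cost_bound (Cond e p q) = bcost e + 1 + (cost_bound p + cost_bound q)"
| "cost_bound (While e p) = 0"

lemma runs_loop_free:
  assumes "loop_free p" "Q (result p s)"
  shows "runs p s (cost_bound p) Q"
  using assms
proof (induction p arbitrary: s Q)
  case (Seq p q)
  have "runs p s (cost_bound p) (\<lambda>s'. s' = result p s)"
    using Seq by simp
  moreover have "runs q (result p s) (cost_bound q) Q"
    using Seq by simp
  ultimately show ?case
    using runs_Seq[of p s "cost_bound p" "\<lambda>s'. s' = result p s" q "cost_bound q" Q] by simp
next
  case (Cond e p q)
  have "runs (Cond e p q) s (bcost e + 1 + max (cost_bound p) (cost_bound q)) Q"
    using Cond by (intro runs_Cond) auto
  then show ?case
    by (rule runs_weaken) auto
qed (use runs_Skip runs_IAssign runs_RAssign in auto)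

primrec iwrites :: "com \<Rightarrow> string set" where
  "iwrites Skip = {}"
| "iwrites (IAssign X e f) = {X}"
| "iwrites (RAssign X e f) = {}"
| "iwrites (Seq p q) = iwrites p \<union> iwrites q"
| "iwrites (Cond e p q) = iwrites p \<union> iwrites q"
| "iwrites (While e p) = iwrites p"

primrec rwrites :: "com \<Rightarrow> string set" where
  "rwrites Skip = {}"
| "rwrites (IAssign X e f) = {}"
| "rwrites (RAssign X e f) = {X}"
| "rwrites (Seq p q) = rwrites p \<union> rwrites q"
| "rwrites (Cond e p q) = rwrites p \<union> rwrites q"
| "rwrites (While e p) = rwrites p"

text \<open>The frame is tracked per array name and read off the syntax, so facts about arrays that
  a phase does not write survive it without mention in its postcondition.\<close>

definition unchanged :: "com \<Rightarrow> memory \<Rightarrow> memory \<Rightarrow> bool" where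
  "unchanged p s s' \<longleftrightarrow>
     (\<forall>X. X \<notin> iwrites p \<longrightarrow> icells s' X = icells s X) \<and>
     (\<forall>X. X \<notin> rwrites p \<longrightarrow> rcells s' X = rcells s X)"

lemma icells_iupdate [simp]:
  "icells (iupdate X k v s) = (icells s)(X := (icells s X)(k := v))"
  "rcells (iupdate X k v s) = rcells s"
  by (simp_all add: iupdate_def)

lemma rcells_rupdate [simp]:
  "rcells (rupdate X k v s) = (rcells s)(X := (rcells s X)(k := v))"
  "icells (rupdate X k v s) = icells s"
  by (simp_all add: rupdate_def)

lemma exec_unchanged: "exec p s t s' \<Longrightarrow> unchanged p s s'"
  by (induction rule: exec.induct) (simp_all add: unchanged_def)

lemma runs_unchanged:
  assumes "runs p s T Q"
  shows "runs p s T (\<lambda>s'. Q s' \<and> unchanged p s s')"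
  using assms exec_unchanged unfolding runs_def by blast

abbreviation IVar :: "string \<Rightarrow> iexp" where "IVar X \<equiv> ICell X (IConst 0)"
abbreviation RVar :: "string \<Rightarrow> rexp" where "RVar X \<equiv> RCell X (IConst 0)"
abbreviation ISet :: "string \<Rightarrow> iexp \<Rightarrow> com" where "ISet X \<equiv> IAssign X (IConst 0)"
abbreviation RSet :: "string \<Rightarrow> rexp \<Rightarrow> com" where "RSet X \<equiv> RAssign X (IConst 0)"

definition For :: "string \<Rightarrow> string \<Rightarrow> com \<Rightarrow> com" where
  "For X N p = Seq (ISet X (IConst 0))
     (While (BNot (ILe (IVar N) (IVar X))) (Seq p (ISet X (IAdd (IVar X) (IConst 1)))))"

lemma writes_For [simp]:
  "iwrites (For X N p) = insert X (iwrites p)"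
  "rwrites (For X N p) = rwrites p"
  by (auto simp: For_def)

text \<open>The premise \<open>inv\<close> keeps \<open>Inv\<close> independent of the counter
  array; the counter value reaches the body separately. Guard and increment cost 13 steps per round.
  Initialization and the last failing test cost 10 more, which \<open>0 < m\<close> lets one round
  absorb: 13 + 10 = 23.\<close>

lemma runs_For:
  assumes bound: "icells s N 0 = int m" "0 < m" and names: "X \<noteq> N" "X \<notin> iwrites p" "N \<notin> iwrites p"
    and init: "Inv 0 (iupdate X 0 0 s)"
    and inv: "\<And>k s s'. Inv k s \<Longrightarrow> rcells s' = rcells s \<Longrightarrow>
        (\<And>Y. Y \<noteq> X \<Longrightarrow> icells s' Y = icells s Y) \<Longrightarrow> Inv k s'"
    and step: "\<And>k s'. k < m \<Longrightarrow> icells s' X 0 = int k \<Longrightarrow> unchanged (For X N p) s s' \<Longrightarrow>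
        Inv k s' \<Longrightarrow> runs p s' T (Inv (Suc k))"
  shows "runs (For X N p) s (m * (T + 23)) (Inv m)"
proof -
  let ?g = "BNot (ILe (IVar N) (IVar X))"
  let ?b = "Seq p (ISet X (IAdd (IVar X) (IConst 1)))"
  have loop: "runs (While ?g ?b) s' (7 + (m - k) * (T + 13)) (Inv m)"
    if "k \<le> m" "icells s' X 0 = int k" "unchanged (For X N p) s s'" "Inv k s'" for k s'
    using that
  proof (induction "m - k" arbitrary: k s')
    case 0
    have "icells s' N = icells s N"
      using 0 names by (simp add: unchanged_def)
    then have "\<not> bval ?g s'" "m = k"
      using 0 bound by simp_all
    then show ?case
      using 0 exec_WhileFalse[of ?g s' ?b]
      unfolding runs_def by (intro exI[of _ "bcost ?g + 1"] exI[of _ s']) simp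
  next
    case (Suc j)
    then have k: "k < m" by simp
    have N: "icells s' N = icells s N"
      using Suc names by (simp add: unchanged_def)
    have g: "bval ?g s'"
      using k bound Suc N by simp
    obtain t s1 where 1: "exec p s' t s1" "t \<le> T" "Inv (Suc k) s1"
      using step[OF k] Suc unfolding runs_def by blast
    have u1: "unchanged p s' s1"
      using 1 exec_unchanged by blast
    define s2 where "s2 = iupdate X 0 (icells s1 X 0 + 1) s1"
    have X2: "icells s2 X 0 = int (Suc k)"
      using u1 names Suc by (simp add: s2_def unchanged_def)
    have "exec (ISet X (IAdd (IVar X) (IConst 1))) s1 6 s2"
      using exec_IAssign[of X "IConst 0" "IAdd (IVar X) (IConst 1)" s1] by (simp add: s2_def numeral_eq_Suc)
    with 1 have b: "exec ?b s' (t + 6) s2"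
      by (rule_tac exec_Seq)
    have I2: "Inv (Suc k) s2"
      by (rule inv[OF 1(3)]) (simp_all add: s2_def)
    have "unchanged (For X N p) s s2"
      using u1 Suc by (simp add: s2_def unchanged_def)
    then have "runs (While ?g ?b) s2 (7 + (m - Suc k) * (T + 13)) (Inv m)"
      using Suc.hyps(1)[of "Suc k" s2] Suc.hyps(2) k X2 I2 by simp
    then obtain t' s3 where 3: "exec (While ?g ?b) s2 t' s3" "t' \<le> 7 + (m - Suc k) * (T + 13)" "Inv m s3"
      unfolding runs_def by blast
    have "exec (While ?g ?b) s' (bcost ?g + 1 + (t + 6) + t') s3"
      using g b 3 by (intro exec_WhileTrue)
    moreover have "m - k = Suc (m - Suc k)"
      using k by simp
    ultimately show ?case
      using 1 3 unfolding runs_def by (intro exI conjI) (assumption, auto)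
  qed
  have "runs (ISet X (IConst 0)) s 3 (\<lambda>s'. s' = iupdate X 0 0 s)"
    using runs_IAssign[of _ X "IConst 0" s "IConst 0"] by (simp add: numeral_eq_Suc)
  then have "runs (For X N p) s (3 + (7 + (m - 0) * (T + 13))) (Inv m)"
    unfolding For_def
    by (rule runs_Seq, intro loop)
       (use init in \<open>auto simp: unchanged_def\<close>)
  then show ?thesis
    by (rule runs_weaken) (use \<open>0 < m\<close> in \<open>auto simp: algebra_simps\<close>)
qed

lemma runs_straight:
  assumes "loop_free p" "cost_bound p \<le> T" "Q (result p s)"
  shows "runs p s T Q"
  using runs_weaken[OF runs_loop_free[of p Q s] assms(2)] assms by blast

lemma runs_Seq':
  assumes "runs p s T R" "\<And>s'. R s' \<Longrightarrow> unchanged p s s' \<Longrightarrow> runs q s' T' Q" "T + T' \<le> T''"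
  shows "runs (Seq p q) s T'' Q"
  using runs_weaken[OF runs_Seq[OF runs_unchanged[OF assms(1)]] assms(3)] assms(2) by blast

lemma rupdate_same: "rupdate X k (rcells s X k) s = s"
  by (simp add: rupdate_def)

text \<open>Moves the case distinction from the memory into the stored value, so that a chain of
  such conditionals stays one linear chain of updates.\<close>

lemma result_Cond_Skip:
  "result (Cond e (RSet X f) Skip) s = rupdate X 0 (if bval e s then rval f s else rcells s X 0) s"
  by (simp add: rupdate_same)

section \<open>Loads of independent uniform items\<close>

lemma integral_uniform_measure_Icc:
  fixes f :: "real \<Rightarrow> real"
  assumes "l < u" and [measurable]: "f \<in> borel_measurable borel"
  shows "(\<integral>x. f x \<partial>uniform_measure lborel {l..u}) = (\<integral>x. f x * indicator {l..u} x \<partial>lborel) / (u - l)"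
proof -
  have "uniform_measure lborel {l..u} = density lborel (\<lambda>x. ennreal (indicator {l..u} x / (u - l)))"
    unfolding uniform_measure_def using assms
    by (intro density_cong) (auto simp: divide_ennreal[of 1, simplified] split: split_indicator)
  moreover have "(\<integral>x. f x \<partial>density lborel (\<lambda>x. ennreal (indicator {l..u} x / (u - l)))) =
      (\<integral>x. (f x * indicator {l..u} x) / (u - l) \<partial>lborel)"
    using assms by (subst integral_density) (auto intro!: Bochner_Integration.integral_cong split: split_indicator)
  ultimately show ?thesis
    by simp
qed

locale uniform_items =
  fixes a :: "nat \<Rightarrow> nat" and l u :: "nat \<Rightarrow> real"
  assumes size_pos: "\<And>j. 0 < a j" and bounds: "\<And>j. l j < u j"
begin

definition U :: "nat \<Rightarrow> real measure" where
  "U j = uniform_measure lborel {l j..u j}"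

lemma sets_U [simp, measurable_cong]: "sets (U j) = sets borel"
  by (simp add: U_def)

lemma space_U [simp]: "space (U j) = UNIV"
  by (simp add: U_def)

lemma prob_space_U: "prob_space (U j)"
  unfolding U_def using bounds[of j] by (intro prob_space_uniform_measure) auto

sublocale U: product_prob_space U
  by (intro product_prob_spaceI prob_space_U)

lemma prob_space_PiM_U: "prob_space (PiM J U)"
  by (intro prob_space_PiM prob_space_U)

text \<open>The probability that the ratio \<open>c j / a j\<close> exceeds \<open>t\<close>, in the
  clamped form that the program computes with one division and two comparisons.\<close>

definition above_prob :: "nat \<Rightarrow> real \<Rightarrow> real" where
  "above_prob j t = min 1 (max 0 ((u j - real (a j) * t) / (u j - l j)))"

lemma above_prob_measurable [measurable]: "above_prob j \<in> borel_measurable borel"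
  unfolding above_prob_def by measurable

lemma above_prob_cases:
  "u j \<le> real (a j) * t \<Longrightarrow> above_prob j t = 0"
  "real (a j) * t \<le> l j \<Longrightarrow> above_prob j t = 1"
  "l j \<le> real (a j) * t \<Longrightarrow> real (a j) * t \<le> u j \<Longrightarrow> above_prob j t = (u j - real (a j) * t) / (u j - l j)"
proof -
  show "u j \<le> real (a j) * t \<Longrightarrow> above_prob j t = 0"
    using bounds[of j] by (auto simp: above_prob_def divide_nonpos_pos max_def zero_le_divide_iff)
  show "real (a j) * t \<le> l j \<Longrightarrow> above_prob j t = 1"
    using bounds[of j] by (auto simp: above_prob_def min_def max_def field_simps)
  show "l j \<le> real (a j) * t \<Longrightarrow> real (a j) * t \<le> u j \<Longrightarrow> above_prob j t = (u j - real (a j) * t) / (u j - l j)"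
    using bounds[of j] by (auto simp: above_prob_def min_def max_def field_simps)
qed

lemma measure_U_above: "measure (U j) {real (a j) * t<..} = above_prob j t"
proof -
  have "measure (U j) {real (a j) * t<..} = measure lborel ({l j..u j} \<inter> {real (a j) * t<..}) / (u j - l j)"
    unfolding U_def using bounds[of j] by (subst measure_uniform_measure) auto
  also have "\<dots> = above_prob j t"
  proof -
    consider "u j \<le> real (a j) * t" | "real (a j) * t < l j" | "l j \<le> real (a j) * t" "real (a j) * t < u j"
      by linarith
    then show ?thesis
    proof cases
      case 1
      then have "{l j..u j} \<inter> {real (a j) * t<..} = {}" by auto
      then show ?thesis using 1 above_prob_cases by simp
    next
      case 2
      then have "{l j..u j} \<inter> {real (a j) * t<..} = {l j..u j}" by auto
      then show ?thesis using 2 above_prob_cases bounds[of j] by simp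
    next
      case 3
      then have "{l j..u j} \<inter> {real (a j) * t<..} = {real (a j) * t<..u j}" by auto
      then show ?thesis using 3 above_prob_cases bounds[of j] by simp
    qed
  qed
  finally show ?thesis .
qed

lemma integral_U_above: "(\<integral>y. of_bool (real (a j) * t < y) \<partial>U j) = above_prob j t"
proof -
  have "(\<integral>y. of_bool (real (a j) * t < y) \<partial>U j) = (\<integral>y. indicator {real (a j) * t<..} y \<partial>U j)"
    by (intro Bochner_Integration.integral_cong) (auto split: split_indicator)
  also have "\<dots> = above_prob j t"
    by (simp add: measure_U_above)
  finally show ?thesis .
qed

text \<open>For \<open>t\<close> the ratio of an item outside \<open>J\<close>, this is the capacity
  consumed before that item is packed, if \<open>J\<close> holds the other items.\<close>

definition load :: "nat set \<Rightarrow> real \<Rightarrow> (nat \<Rightarrow> real) \<Rightarrow> real" where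
  "load J t c = (\<Sum>j\<in>J. if real (a j) * t < c j then real (a j) else 0)"

text \<open>The size \<open>s\<close> is an integer, not a natural number, so that the shift by
  \<open>a j\<close> in the recursion needs no case distinction.\<close>

definition load_prob :: "nat set \<Rightarrow> real \<Rightarrow> int \<Rightarrow> real" where
  "load_prob J t s = (\<integral>c. of_bool (load J t c = of_int s) \<partial>PiM J U)"

lemma load_measurable [measurable]:
  assumes "J \<subseteq> K" "h \<in> borel_measurable (PiM K U)"
  shows "(\<lambda>c. load J (h c) c) \<in> borel_measurable (PiM K U)"
proof -
  have [measurable]: "(\<lambda>c. c j) \<in> borel_measurable (PiM K U)" if "j \<in> J" for j
    using that assms measurable_component_singleton[of j K U] by auto
  note [measurable] = assms(2)
  show ?thesis
    unfolding load_def by (intro borel_measurable_sum) measurable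
qed

lemma integrable_PiM_bounded:
  fixes f :: "_ \<Rightarrow> real"
  assumes "f \<in> borel_measurable (PiM K U)" "\<And>c. \<bar>f c\<bar> \<le> B"
  shows "integrable (PiM K U) f"
proof -
  interpret prob_space "PiM K U" by (rule prob_space_PiM_U)
  show ?thesis
    by (rule integrable_const_bound[of _ B]) (use assms in auto)
qed

lemma integrable_U_bounded:
  fixes f :: "_ \<Rightarrow> real"
  assumes "f \<in> borel_measurable borel" "\<And>c. \<bar>f c\<bar> \<le> B"
  shows "integrable (U j) f"
  by (rule U.M.integrable_const_bound[where B = B]) (use assms in auto)

lemma load_cong:
  assumes "\<And>j. j \<in> J \<Longrightarrow> c j = c' j"
  shows "load J t c = load J t c'"
  using assms unfolding load_def by (intro sum.cong) auto

lemma load_prob_empty: "load_prob {} t s = of_bool (s = 0)"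
proof -
  interpret prob_space "PiM {} U" by (rule prob_space_PiM_U)
  show ?thesis
    by (simp add: load_prob_def load_def prob_space del: PiM_empty)
qed

text \<open>By independence, component \<open>j\<close> can be integrated out first: item
  \<open>j\<close> adds \<open>a j\<close> to the load with probability
  \<open>above_prob j t\<close> and nothing otherwise.\<close>

lemma load_prob_insert:
  assumes "finite J" "j \<notin> J"
  shows "load_prob (insert j J) t s =
    (1 - above_prob j t) * load_prob J t s + above_prob j t * load_prob J t (s - int (a j))"
proof -
  let ?f = "\<lambda>s c. of_bool (load J t c = of_int s) :: real"
  have int: "integrable (PiM J U) (?f s)" for s
    by (rule integrable_PiM_bounded[of _ _ 1]) (use load_measurable[of J J "\<lambda>_. t"] in measurable)
  have "load_prob (insert j J) t s =
      (\<integral>x. (\<integral>y. of_bool (load (insert j J) t (x(j := y)) = of_int s) \<partial>U j) \<partial>PiM J U)"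
    unfolding load_prob_def
    by (rule U.product_integral_insert[OF assms], rule integrable_PiM_bounded[of _ _ 1])
       (use load_measurable[of "insert j J" "insert j J" "\<lambda>_. t"] in measurable)
  \<comment> \<open>Writing the case distinction as base value plus indicator times difference makes
    the inner integral linear in the only term that depends on \<open>y\<close>.\<close>
  also have "\<dots> = (\<integral>x. (\<integral>y. ?f s x + of_bool (real (a j) * t < y) * (?f (s - int (a j)) x - ?f s x) \<partial>U j) \<partial>PiM J U)"
  proof (intro Bochner_Integration.integral_cong refl)
    fix x y
    have "load J t (x(j := y)) = load J t x"
      using assms by (intro load_cong) auto
    then have "load (insert j J) t (x(j := y)) = (if real (a j) * t < y then real (a j) else 0) + load J t x"
      using assms by (simp add: load_def)
    then show "of_bool (load (insert j J) t (x(j := y)) = real_of_int s) =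
        ?f s x + of_bool (real (a j) * t < y) * (?f (s - int (a j)) x - ?f s x)"
      by auto
  qed
  also have "\<dots> = (\<integral>x. ?f s x + above_prob j t * (?f (s - int (a j)) x - ?f s x) \<partial>PiM J U)"
  proof (intro Bochner_Integration.integral_cong refl)
    fix x
    have "integrable (U j) (\<lambda>y. of_bool (real (a j) * t < y) :: real)"
      by (rule integrable_U_bounded[of _ 1]) auto
    then show "(\<integral>y. ?f s x + of_bool (real (a j) * t < y) * (?f (s - int (a j)) x - ?f s x) \<partial>U j) =
        ?f s x + above_prob j t * (?f (s - int (a j)) x - ?f s x)"
      by (simp add: integral_U_above prob_space.prob_space[OF prob_space_U, simplified])
  qed
  also have "\<dots> = load_prob J t s + above_prob j t * (load_prob J t (s - int (a j)) - load_prob J t s)"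
    using int[of s] int[of "s - int (a j)"] unfolding load_prob_def by simp
  finally show ?thesis
    by (simp add: algebra_simps)
qed

text \<open>The recursion exhibits \<open>load_prob\<close> as a polynomial in the measurable
  functions \<open>above_prob j\<close>, so no joint measurability in \<open>t\<close> and
  \<open>c\<close> is involved.\<close>

lemma load_prob_measurable [measurable]:
  "finite J \<Longrightarrow> (\<lambda>t. load_prob J t s) \<in> borel_measurable borel"
  by (induction J arbitrary: s rule: finite_induct) (simp_all add: load_prob_empty load_prob_insert)

lemma load_prob_bounds: "0 \<le> load_prob J t s" "load_prob J t s \<le> 1"
proof -
  interpret prob_space "PiM J U" by (rule prob_space_PiM_U)
  show "0 \<le> load_prob J t s"
    unfolding load_prob_def by (intro Bochner_Integration.integral_nonneg) auto
  have "load_prob J t s \<le> (\<integral>c. 1 \<partial>PiM J U)"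
    unfolding load_prob_def
    by (intro integral_mono integrable_PiM_bounded[of _ _ 1])
       (use load_measurable[of J J "\<lambda>_. t"] in \<open>auto\<close>)
  then show "load_prob J t s \<le> 1"
    using prob_space by simp
qed

text \<open>The event is that \<open>i\<close> is profitable and starts being packed exactly at
  capacity \<open>s\<close>, when \<open>J\<close> consists of the other items.\<close>

definition crit_prob :: "nat \<Rightarrow> nat set \<Rightarrow> int \<Rightarrow> real" where
  "crit_prob i J s =
     (\<integral>c. of_bool (0 < c i \<and> load J (c i / real (a i)) c = of_int s) \<partial>PiM (insert i J) U)"

lemma crit_measurable:
  "(\<lambda>c. of_bool (0 < c i \<and> load J (c i / real (a i)) c = of_int s) :: real) \<in> borel_measurable (PiM (insert i J) U)"
proof -
  have [measurable]: "(\<lambda>c. c i) \<in> borel_measurable (PiM (insert i J) U)"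
    using measurable_component_singleton[of i "insert i J" U] by auto
  have [measurable]: "(\<lambda>c. load J (c i / real (a i)) c) \<in> borel_measurable (PiM (insert i J) U)"
    by (rule load_measurable) auto
  show ?thesis
    by measurable
qed

lemma crit_prob_eq:
  assumes "finite J" "i \<notin> J"
  shows "crit_prob i J s = (\<integral>y. of_bool (0 < y) * load_prob J (y / real (a i)) s \<partial>U i)"
proof -
  let ?f = "\<lambda>c. of_bool (0 < c i \<and> load J (c i / real (a i)) c = of_int s) :: real"
  let ?g = "\<lambda>y. of_bool (0 < y) * load_prob J (y / real (a i)) s"
  note [measurable] = crit_measurable[of i J s]
  have int: "integrable (PiM (insert i J) U) ?f"
    by (rule integrable_PiM_bounded[of _ _ 1]) auto
  have [measurable]: "?g \<in> borel_measurable borel"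
    using assms by measurable
  have int': "integrable (U i) ?g"
    by (rule integrable_U_bounded[of _ 1]) (use load_prob_bounds in auto)
  \<comment> \<open>Tonelli, with item \<open>i\<close> integrated last: for fixed
    \<open>c i = y\<close> the threshold ratio is a constant and the inner integral is a
    \<open>load_prob\<close>.\<close>
  have "ennreal (crit_prob i J s) = (\<integral>\<^sup>+c. ennreal (?f c) \<partial>PiM (insert i J) U)"
    unfolding crit_prob_def using int by (intro nn_integral_eq_integral[symmetric]) auto
  also have "\<dots> = (\<integral>\<^sup>+y. (\<integral>\<^sup>+x. ennreal (?f (x(i := y))) \<partial>PiM J U) \<partial>U i)"
    using assms by (intro U.product_nn_integral_insert_rev) measurable
  also have "\<dots> = (\<integral>\<^sup>+y. ennreal (?g y) \<partial>U i)"
  proof (intro nn_integral_cong)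
    fix y
    have eq: "?f (x(i := y)) = of_bool (0 < y) * of_bool (load J (y / real (a i)) x = of_int s)" for x
    proof -
      have "load J (y / real (a i)) (x(i := y)) = load J (y / real (a i)) x"
        using assms by (intro load_cong) auto
      then show ?thesis by simp
    qed
    have int: "integrable (PiM J U) (\<lambda>x. of_bool (load J (y / real (a i)) x = of_int s) :: real)"
      by (rule integrable_PiM_bounded[of _ _ 1]) (use load_measurable[of J J "\<lambda>_. y / real (a i)"] in measurable)
    show "(\<integral>\<^sup>+x. ennreal (?f (x(i := y))) \<partial>PiM J U) = ennreal (?g y)"
      unfolding eq load_prob_def using int
      by (subst nn_integral_eq_integral) auto
  qed
  also have "\<dots> = ennreal (\<integral>y. ?g y \<partial>U i)"
    using int' load_prob_bounds by (intro nn_integral_eq_integral) auto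
  finally show ?thesis
    by (subst (asm) ennreal_inj)
      (auto simp: crit_prob_def load_prob_bounds intro!: Bochner_Integration.integral_nonneg)
qed

section \<open>Exact integration between consecutive break points\<close>

definition no_break :: "real \<Rightarrow> real \<Rightarrow> nat \<Rightarrow> bool" where
  "no_break \<alpha> \<beta> j \<longleftrightarrow> (\<forall>q\<in>{l j / real (a j), u j / real (a j)}. q \<le> \<alpha> \<or> \<beta> \<le> q)"

text \<open>The excluded points are the two kinks of \<open>above_prob j\<close>. On the interval
  the function is therefore constantly 0, constantly 1, or given by the linear formula.\<close>

lemma no_break_cases:
  assumes "no_break \<alpha> \<beta> j" "\<alpha> \<le> \<beta>"
  obtains "u j \<le> real (a j) * \<alpha>" | "real (a j) * \<beta> \<le> l j"
    | "l j \<le> real (a j) * \<alpha>" "real (a j) * \<beta> \<le> u j"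
  using assms size_pos[of j] unfolding no_break_def
  by (auto simp: field_simps)

lemma above_prob_linear:
  assumes "no_break \<alpha> \<beta> j" "\<alpha> \<le> \<beta>" "0 \<le> v" "v \<le> 1"
  shows "above_prob j (\<alpha> + (\<beta> - \<alpha>) * v) = above_prob j \<alpha> + (above_prob j \<beta> - above_prob j \<alpha>) * v"
proof -
  define t where "t = \<alpha> + (\<beta> - \<alpha>) * v"
  have "(\<beta> - \<alpha>) * v \<le> (\<beta> - \<alpha>) * 1" "0 \<le> (\<beta> - \<alpha>) * v"
    using assms by (auto intro!: mult_left_mono simp del: mult_1_right)
  then have t: "\<alpha> \<le> t" "t \<le> \<beta>"
    by (auto simp: t_def)
  then have at: "real (a j) * \<alpha> \<le> real (a j) * t" "real (a j) * t \<le> real (a j) * \<beta>"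
    by (auto intro: mult_left_mono)
  from assms(1,2) have "above_prob j t = above_prob j \<alpha> + (above_prob j \<beta> - above_prob j \<alpha>) * v"
  proof (cases rule: no_break_cases)
    case 1
    then show ?thesis using at by (simp add: above_prob_cases(1))
  next
    case 2
    then show ?thesis using at by (simp add: above_prob_cases(2))
  next
    case 3
    then have "above_prob j x = (u j - real (a j) * x) / (u j - l j)" if "x \<in> {\<alpha>, t, \<beta>}" for x
      using that at by (intro above_prob_cases(3)) auto
    then have eqs: "above_prob j \<alpha> = (u j - real (a j) * \<alpha>) / (u j - l j)"
      "above_prob j \<beta> = (u j - real (a j) * \<beta>) / (u j - l j)"
      "above_prob j t = (u j - real (a j) * t) / (u j - l j)"
      by simp_all
    show ?thesis
      unfolding eqs using bounds[of j] by (simp add: t_def divide_simps) (simp add: algebra_simps)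
  qed
  then show ?thesis
    by (simp add: t_def)
qed

text \<open>Neither end of the support of item \<open>i\<close> lies strictly inside the interval.
  Hence, conditionally on the ratio lying there, \<open>v\<close> is uniform on [0, 1] with moments
  \<open>1/(k+1)\<close>, and the factor in front is the probability of that condition.\<close>

lemma interval_integral:
  fixes g :: "real \<Rightarrow> real"
  assumes le: "\<alpha> \<le> \<beta>" and nb: "no_break \<alpha> \<beta> i"
    and g: "\<And>v. 0 \<le> v \<Longrightarrow> v \<le> 1 \<Longrightarrow> g (\<alpha> + (\<beta> - \<alpha>) * v) = (\<Sum>k<m. C k * v ^ k)"
    and [measurable]: "g \<in> borel_measurable borel"
  shows "(\<integral>y. of_bool (real (a i) * \<alpha> < y \<and> y \<le> real (a i) * \<beta>) * g (y / real (a i)) \<partial>U i) =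
    (above_prob i \<alpha> - above_prob i \<beta>) * (\<Sum>k<m. C k / (real k + 1))" (is "?L = ?R")
proof (cases "\<alpha> = \<beta>")
  case True
  then have "(\<lambda>y. of_bool (real (a i) * \<alpha> < y \<and> y \<le> real (a i) * \<beta>) * g (y / real (a i))) = (\<lambda>_. 0)"
    by auto
  then show ?thesis
    using True by simp
next
  case False
  with le have lt: "\<alpha> < \<beta>" by simp
  have ai: "0 < real (a i)" using size_pos by simp
  have lt': "real (a i) * \<alpha> < real (a i) * \<beta>"
    using lt ai by simp
  let ?h = "\<lambda>y. of_bool (real (a i) * \<alpha> < y \<and> y \<le> real (a i) * \<beta>) * g (y / real (a i)) * indicator {l i..u i} y"
  have L: "?L = (\<integral>y. ?h y \<partial>lborel) / (u i - l i)"
    unfolding U_def by (rule integral_uniform_measure_Icc[OF bounds]) measurable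
  from nb le show ?thesis
  proof (cases rule: no_break_cases)
    case 1
    then have "?h = (\<lambda>_. 0)"
      by (auto split: split_indicator)
    then have "?L = 0"
      unfolding L by simp
    then show ?thesis
      using 1 lt' by (simp add: above_prob_cases(1))
  next
    case 2
    \<comment> \<open>The interval lies below the support and can meet it only in the point
      \<open>l i\<close>.\<close>
    have "AE y in lborel. ?h y = 0"
      using AE_lborel_singleton[of "l i"] by eventually_elim (use 2 in \<open>auto split: split_indicator\<close>)
    then have "?L = 0"
      unfolding L by (subst integral_eq_zero_AE) auto
    then show ?thesis
      using 2 lt' by (simp add: above_prob_cases(2))
  next
    case 3
    \<comment> \<open>\<open>z\<close> inverts the affine substitution and \<open>F\<close> is an
      antiderivative of \<open>f\<close>; the factor \<open>a i * (\<beta> - \<alpha>)\<close>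
      undoes the derivative of \<open>z\<close>.\<close>
    define z where "z = (\<lambda>y. (y / real (a i) - \<alpha>) / (\<beta> - \<alpha>))"
    define f where "f = (\<lambda>y. \<Sum>k<m. C k * z y ^ k)"
    define F where "F = (\<lambda>y. real (a i) * (\<beta> - \<alpha>) * (\<Sum>k<m. C k / (real k + 1) * z y ^ Suc k))"
    have [measurable]: "f \<in> borel_measurable borel"
      unfolding f_def z_def by measurable
    have dz: "(z has_real_derivative 1 / (real (a i) * (\<beta> - \<alpha>))) (at y within S)" for y S
      unfolding z_def using ai lt by (auto intro!: derivative_eq_intros)
    \<comment> \<open>Passing from the half-open to the closed interval changes the integrand at its
      left end only.\<close>
    have "AE y in lborel. ?h y = f y * indicator {real (a i) * \<alpha>..real (a i) * \<beta>} y"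
      using AE_lborel_singleton[of "real (a i) * \<alpha>"]
    proof eventually_elim
      case (elim y)
      show ?case
      proof (cases "real (a i) * \<alpha> < y \<and> y \<le> real (a i) * \<beta>")
        case True
        then have "0 \<le> z y" "z y \<le> 1" "y / real (a i) = \<alpha> + (\<beta> - \<alpha>) * z y"
          using ai lt by (auto simp: z_def field_simps)
        then have "g (y / real (a i)) = f y"
          using g[of "z y"] by (simp add: f_def)
        then show ?thesis
          using True 3 by (auto split: split_indicator)
      next
        case False
        then show ?thesis
          using elim by (auto split: split_indicator)
      qed
    qed
    then have "(\<integral>y. ?h y \<partial>lborel) = (\<integral>y. f y * indicator {real (a i) * \<alpha>..real (a i) * \<beta>} y \<partial>lborel)"
      by (intro integral_cong_AE) auto
    also have "\<dots> = F (real (a i) * \<beta>) - F (real (a i) * \<alpha>)"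
    proof (rule integral_FTC_Icc_real)
      fix y
      have "((\<lambda>y. C k / (real k + 1) * z y ^ Suc k) has_real_derivative
          C k * z y ^ k * (1 / (real (a i) * (\<beta> - \<alpha>)))) (at y)" for k
        by (rule derivative_eq_intros dz refl)+ (use ai lt in \<open>simp add: divide_simps\<close>)
      then have "(F has_real_derivative real (a i) * (\<beta> - \<alpha>) * (\<Sum>k<m. C k * z y ^ k * (1 / (real (a i) * (\<beta> - \<alpha>))))) (at y)"
        unfolding F_def by (intro DERIV_cmult DERIV_sum)
      moreover have "real (a i) * (\<beta> - \<alpha>) * (\<Sum>k<m. C k * z y ^ k * (1 / (real (a i) * (\<beta> - \<alpha>)))) = f y"
        unfolding f_def sum_distrib_right[symmetric] using ai lt by simp
      ultimately show "(F has_real_derivative f y) (at y)"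
        by simp
      have "isCont z y"
        using dz DERIV_isCont by blast
      then show "isCont f y"
        unfolding f_def by (intro continuous_intros)
    qed (use lt' in simp)
    also have "\<dots> = real (a i) * (\<beta> - \<alpha>) * (\<Sum>k<m. C k / (real k + 1))"
      using ai lt by (simp add: F_def z_def)
    finally have "?L = real (a i) * (\<beta> - \<alpha>) * (\<Sum>k<m. C k / (real k + 1)) / (u i - l i)"
      unfolding L by simp
    moreover have "above_prob i \<alpha> - above_prob i \<beta> = real (a i) * (\<beta> - \<alpha>) / (u i - l i)"
      using 3 lt' by (simp add: above_prob_cases(3) diff_divide_distrib[symmetric] algebra_simps)
    ultimately show ?thesis
      by simp
  qed
qed

text \<open>Half-open intervals partition the range from 0 to \<open>a i * t K\<close> even when
  some are empty, and \<open>top\<close> makes the values beyond that range a null event.\<close>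

lemma integral_positive_split:
  fixes g :: "real \<Rightarrow> real"
  assumes "t 0 = 0" and mono: "\<And>k. t k \<le> t (Suc k)" and top: "u i \<le> real (a i) * t K"
    and [measurable]: "g \<in> borel_measurable borel" and B: "\<And>x. \<bar>g x\<bar> \<le> B"
  shows "(\<integral>y. of_bool (0 < y) * g (y / real (a i)) \<partial>U i) =
    (\<Sum>k<K. \<integral>y. of_bool (real (a i) * t k < y \<and> y \<le> real (a i) * t (Suc k)) * g (y / real (a i)) \<partial>U i)"
proof -
  have split: "of_bool (0 < y \<and> y \<le> real (a i) * t k) =
      (\<Sum>k<k. of_bool (real (a i) * t k < y \<and> y \<le> real (a i) * t (Suc k)) :: real)" for y k
  proof (induction k)
    case 0
    then show ?case using assms by simp
  next
    case (Suc k)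
    have "0 \<le> t k"
      using \<open>t 0 = 0\<close> mono by (induction k) (auto intro: order_trans)
    then have "0 \<le> real (a i) * t k" "real (a i) * t k \<le> real (a i) * t (Suc k)"
      using mono by (auto intro: mult_left_mono)
    then show ?case
      using Suc[symmetric] by auto
  qed
  have "AE y in U i. y \<le> u i"
    unfolding U_def using bounds[of i] by (intro AE_uniform_measureI) auto
  then have "(\<integral>y. of_bool (0 < y) * g (y / real (a i)) \<partial>U i) =
      (\<integral>y. of_bool (0 < y \<and> y \<le> real (a i) * t K) * g (y / real (a i)) \<partial>U i)"
    by (intro integral_cong_AE) (measurable, auto elim!: eventually_mono simp: order_trans[OF _ top])
  also have "\<dots> = (\<integral>y. (\<Sum>k<K. of_bool (real (a i) * t k < y \<and> y \<le> real (a i) * t (Suc k)) * g (y / real (a i))) \<partial>U i)"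
    unfolding split sum_distrib_right ..
  also have "\<dots> = (\<Sum>k<K. \<integral>y. of_bool (real (a i) * t k < y \<and> y \<le> real (a i) * t (Suc k)) * g (y / real (a i)) \<partial>U i)"
  proof (intro Bochner_Integration.integral_sum integrable_U_bounded[where B = B])
    show "\<bar>of_bool (real (a i) * t k < y \<and> y \<le> real (a i) * t (Suc k)) * g (y / real (a i))\<bar> \<le> B" for k y
      using B[of "y / real (a i)"] B[of 0] by (auto simp: abs_mult)
  qed measurable
  finally show ?thesis .
qed

text \<open>
  On \<open>[\<alpha>, \<beta>]\<close> put \<open>t = \<alpha> + (\<beta> - \<alpha>) v\<close>.  The generating function of the load, with \<open>x\<close> marking size, is a
  product of the factors \<open>X0 + X1 v + X2 x\<^bsup>a j\<^esup> + X3 v x\<^bsup>a j\<^esup>\<close>.  Item \<open>i\<close> itself contributes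
  \<open>1 - x\<^bsup>a i\<^esup>\<close>, so that summing coefficients up to size \<open>w\<close> yields the probability that \<open>i\<close> is the
  item being packed when the used capacity passes through \<open>w\<close>.
\<close>

definition X0 :: "real \<Rightarrow> real \<Rightarrow> nat \<Rightarrow> nat \<Rightarrow> real" where
  "X0 \<alpha> \<beta> i j = (if j = i then 1 else 1 - above_prob j \<alpha>)"
definition X1 :: "real \<Rightarrow> real \<Rightarrow> nat \<Rightarrow> nat \<Rightarrow> real" where
  "X1 \<alpha> \<beta> i j = (if j = i then 0 else above_prob j \<alpha> - above_prob j \<beta>)"
definition X2 :: "real \<Rightarrow> real \<Rightarrow> nat \<Rightarrow> nat \<Rightarrow> real" where
  "X2 \<alpha> \<beta> i j = (if j = i then -1 else above_prob j \<alpha>)"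
definition X3 :: "real \<Rightarrow> real \<Rightarrow> nat \<Rightarrow> nat \<Rightarrow> real" where
  "X3 \<alpha> \<beta> i j = (if j = i then 0 else above_prob j \<beta> - above_prob j \<alpha>)"

text \<open>Coefficient of \<open>v^k x^s\<close> in the product of the first \<open>j\<close>
  factors. Integer exponents let the shifts leave the support, where the value is 0.\<close>

primrec bicoef :: "real \<Rightarrow> real \<Rightarrow> nat \<Rightarrow> nat \<Rightarrow> int \<Rightarrow> int \<Rightarrow> real" where
  "bicoef \<alpha> \<beta> i 0 k s = of_bool (k = 0 \<and> s = 0)"
| "bicoef \<alpha> \<beta> i (Suc j) k s =
     X0 \<alpha> \<beta> i j * bicoef \<alpha> \<beta> i j k s + X1 \<alpha> \<beta> i j * bicoef \<alpha> \<beta> i j (k - 1) s +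
     X2 \<alpha> \<beta> i j * bicoef \<alpha> \<beta> i j k (s - int (a j)) + X3 \<alpha> \<beta> i j * bicoef \<alpha> \<beta> i j (k - 1) (s - int (a j))"

text \<open>The same product after the Kronecker substitution \<open>v = x\<^bsup>W\<^esup>\<close>, which stores the polynomial in a
  one-dimensional array.\<close>

primrec kcoef :: "int \<Rightarrow> real \<Rightarrow> real \<Rightarrow> nat \<Rightarrow> nat \<Rightarrow> int \<Rightarrow> real" where
  "kcoef W \<alpha> \<beta> i 0 q = of_bool (q = 0)"
| "kcoef W \<alpha> \<beta> i (Suc j) q =
     X0 \<alpha> \<beta> i j * kcoef W \<alpha> \<beta> i j q + X1 \<alpha> \<beta> i j * kcoef W \<alpha> \<beta> i j (q - W) +
     X2 \<alpha> \<beta> i j * kcoef W \<alpha> \<beta> i j (q - int (a j)) + X3 \<alpha> \<beta> i j * kcoef W \<alpha> \<beta> i j (q - W - int (a j))"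

text \<open>The program relies on this: when multiplying by a factor it also reads \<open>P\<close>
  at negative indices, where zeros must be found.\<close>

lemma kcoef_negative:
  assumes "0 \<le> W" "q < 0" shows "kcoef W \<alpha> \<beta> i j q = 0"
  using assms(2) by (induction j arbitrary: q) (use assms(1) in auto)

text \<open>The correction \<open>of_bool (i < j)\<close> records that the factor of item
  \<open>i\<close> has no \<open>v\<close>. It lowers the final degree to \<open>n - 1\<close>, so
  that \<open>n\<close> rows suffice.\<close>

lemma bicoef_eq_0:
  assumes "k < 0 \<or> int j - of_bool (i < j) < k \<or> s < 0 \<or> int (\<Sum>j'<j. a j') < s"
  shows "bicoef \<alpha> \<beta> i j k s = 0"
  using assms
proof (induction j arbitrary: k s)
  case (Suc j)
  have "bicoef \<alpha> \<beta> i j k s = 0" "bicoef \<alpha> \<beta> i j k (s - int (a j)) = 0"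
    using Suc.prems by (auto intro!: Suc.IH simp: of_bool_def split: if_splits)
  moreover have "bicoef \<alpha> \<beta> i j (k - 1) s = 0" "bicoef \<alpha> \<beta> i j (k - 1) (s - int (a j)) = 0" if "j \<noteq> i"
    using Suc.prems that by (auto intro!: Suc.IH simp: of_bool_def split: if_splits)
  ultimately show ?case
    by (simp add: X1_def X3_def)
qed auto

text \<open>Size exponents stay below \<open>W\<close>, so the two digits of
  \<open>k * W + s\<close> never produce a carry.\<close>

lemma kcoef_eq_bicoef:
  assumes "int (\<Sum>j'<j. a j') < W" "0 \<le> s" "s < W"
  shows "kcoef W \<alpha> \<beta> i j (k * W + s) = bicoef \<alpha> \<beta> i j k s"
  using assms
proof (induction j arbitrary: k s)
  case 0
  have "k * W + s = 0 \<longleftrightarrow> k = 0 \<and> s = 0"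
  proof
    assume eq: "k * W + s = 0"
    then have "W dvd s"
      by (metis add_eq_0_iff dvd_def dvd_minus_iff mult.commute)
    then have "s = 0"
      using 0 zdvd_imp_le by fastforce
    then show "k = 0 \<and> s = 0"
      using eq 0 by auto
  qed auto
  then show ?case by simp
next
  case (Suc j)
  have "int (\<Sum>j'<j. a j') < W"
    using Suc.prems by simp
  note IH = Suc.IH[OF this]
  have shift: "kcoef W \<alpha> \<beta> i j (k * W + s - int (a j)) = bicoef \<alpha> \<beta> i j k (s - int (a j))" for k
  proof (cases "int (a j) \<le> s")
    case True
    then show ?thesis
      using IH[of "s - int (a j)" k] Suc.prems by (simp add: algebra_simps)
  next
    case False
    \<comment> \<open>A borrow: the shifted index falls to the upper end of row
      \<open>k - 1\<close>. The entry there belongs to a size above the total of the first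
      \<open>j\<close> items, hence it is 0.\<close>
    have eq: "k * W + s - int (a j) = (k - 1) * W + (W + s - int (a j))"
      by (simp add: algebra_simps)
    have "0 \<le> int (\<Sum>j'<j. a j')"
      by (rule of_nat_0_le_iff)
    then have "0 \<le> W + s - int (a j)" "W + s - int (a j) < W"
      using Suc.prems False by (auto simp del: of_nat_sum)
    then have "kcoef W \<alpha> \<beta> i j (k * W + s - int (a j)) = bicoef \<alpha> \<beta> i j (k - 1) (W + s - int (a j))"
      unfolding eq by (rule IH)
    also have "\<dots> = 0"
      using Suc.prems by (intro bicoef_eq_0) auto
    also have "\<dots> = bicoef \<alpha> \<beta> i j k (s - int (a j))"
      using False by (intro bicoef_eq_0[symmetric]) auto
    finally show ?thesis .
  qed
  have row: "k * W + s - W = (k - 1) * W + s"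
    by (simp add: algebra_simps)
  show ?case
    unfolding kcoef.simps bicoef.simps row shift using IH[of s] Suc.prems by simp
qed

text \<open>Induction over the factors. Item \<open>i\<close> never enters the load; once its factor
  \<open>1 - x^(a i)\<close> has been multiplied in, the probabilities turn into differences at
  distance \<open>a i\<close>.\<close>

lemma bicoef_poly:
  assumes "i < n" "j \<le> n" "\<And>j. j < n \<Longrightarrow> no_break \<alpha> \<beta> j" "\<alpha> \<le> \<beta>" "0 \<le> v" "v \<le> 1"
  defines "t \<equiv> \<alpha> + (\<beta> - \<alpha>) * v"
  shows "(\<Sum>k<n. bicoef \<alpha> \<beta> i j (int k) s * v ^ k) =
    load_prob ({..<j} - {i}) t s - of_bool (i < j) * load_prob ({..<j} - {i}) t (s - int (a i))"
  using assms(2)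
proof (induction j arbitrary: s)
  case 0
  have "(\<Sum>k<n. bicoef \<alpha> \<beta> i 0 (int k) s * v ^ k) = (\<Sum>k\<in>{0}. bicoef \<alpha> \<beta> i 0 (int k) s * v ^ k)"
    using \<open>i < n\<close> by (intro sum.mono_neutral_right) auto
  then show ?case
    by (simp add: load_prob_empty)
next
  case (Suc j)
  define S where "S = (\<lambda>s. \<Sum>k<n. bicoef \<alpha> \<beta> i j (int k) s * v ^ k)"
  have IH: "S s = load_prob ({..<j} - {i}) t s - of_bool (i < j) * load_prob ({..<j} - {i}) t (s - int (a i))" for s
    using Suc unfolding S_def by simp
  \<comment> \<open>Multiplication by \<open>v\<close> loses no coefficient at the top: for
    \<open>j \<noteq> i\<close> the degree before this factor is below \<open>n - 1\<close>, either
    because \<open>i\<close> came earlier or because \<open>j < i\<close>.\<close>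
  have shift: "(\<Sum>k<n. bicoef \<alpha> \<beta> i j (int k - 1) s * v ^ k) = v * S s" if "j \<noteq> i" for s
  proof -
    obtain n' where n': "n = Suc n'" using \<open>i < n\<close> by (cases n) auto
    have "(\<Sum>k<n. bicoef \<alpha> \<beta> i j (int k - 1) s * v ^ k) = v * (\<Sum>k<n'. bicoef \<alpha> \<beta> i j (int k) s * v ^ k)"
      unfolding n' sum.lessThan_Suc_shift by (simp add: bicoef_eq_0 sum_distrib_left mult_ac)
    moreover have "bicoef \<alpha> \<beta> i j (int n') s = 0"
      using that Suc.prems \<open>i < n\<close> n' by (intro bicoef_eq_0) auto
    ultimately show ?thesis
      by (simp add: S_def n')
  qed
  show ?case
  proof (cases "j = i")
    case True
    have "{..<Suc j} - {i} = {..<j} - {i}"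
      using True by auto
    then show ?thesis
      using True IH unfolding S_def
      by (simp add: X0_def X1_def X2_def X3_def left_diff_distrib sum_subtractf)
  next
    case False
    have p: "above_prob j t = above_prob j \<alpha> + (above_prob j \<beta> - above_prob j \<alpha>) * v"
      unfolding t_def using Suc.prems assms by (intro above_prob_linear) auto
    have "(\<Sum>k<n. bicoef \<alpha> \<beta> i (Suc j) (int k) s * v ^ k) =
      (1 - above_prob j \<alpha>) * S s + (above_prob j \<alpha> - above_prob j \<beta>) * (\<Sum>k<n. bicoef \<alpha> \<beta> i j (int k - 1) s * v ^ k) +
      above_prob j \<alpha> * S (s - int (a j)) +
      (above_prob j \<beta> - above_prob j \<alpha>) * (\<Sum>k<n. bicoef \<alpha> \<beta> i j (int k - 1) (s - int (a j)) * v ^ k)"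
      using False unfolding S_def
      by (simp add: X0_def X1_def X2_def X3_def distrib_right sum.distrib sum_distrib_left mult.assoc)
    then have "(\<Sum>k<n. bicoef \<alpha> \<beta> i (Suc j) (int k) s * v ^ k) =
      (1 - above_prob j t) * S s + above_prob j t * S (s - int (a j))"
      unfolding shift[OF False] p by (simp add: algebra_simps del: bicoef.simps)
    moreover have "{..<Suc j} - {i} = insert j ({..<j} - {i})"
      using False by auto
    moreover have "(i < Suc j) = (i < j)"
      using False by auto
    ultimately show ?thesis
      unfolding IH by (simp add: load_prob_insert algebra_simps del: bicoef.simps)
  qed
qed

lemma crit_prob_diff:
  assumes "i < n" "t 0 = 0" "\<And>k. t k \<le> t (Suc k)" "u i \<le> real (a i) * t K"
    and nb: "\<And>k j. j < n \<Longrightarrow> no_break (t k) (t (Suc k)) j"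
    and W: "int (\<Sum>j<n. a j) < W" "0 \<le> s" "s < W"
  shows "crit_prob i ({..<n} - {i}) s - crit_prob i ({..<n} - {i}) (s - int (a i)) =
    (\<Sum>k<K. (above_prob i (t k) - above_prob i (t (Suc k))) *
       (\<Sum>m<n. kcoef W (t k) (t (Suc k)) i n (int m * W + s) / (real m + 1)))"
proof -
  let ?J = "{..<n} - {i}"
  define g where "g = (\<lambda>t. load_prob ?J t s - load_prob ?J t (s - int (a i)))"
  have [measurable]: "g \<in> borel_measurable borel"
    unfolding g_def by measurable
  have B: "\<bar>g t\<bar> \<le> 1" for t
    unfolding g_def using load_prob_bounds[of ?J t s] load_prob_bounds[of ?J t "s - int (a i)"] by linarith
  have int: "integrable (U i) (\<lambda>y. of_bool (0 < y) * load_prob ?J (y / real (a i)) s)" for s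
    by (rule integrable_U_bounded[where B = 1]) (use load_prob_bounds in auto)
  have "crit_prob i ?J s - crit_prob i ?J (s - int (a i)) = (\<integral>y. of_bool (0 < y) * g (y / real (a i)) \<partial>U i)"
    unfolding g_def right_diff_distrib using int by (simp add: crit_prob_eq)
  also have "\<dots> = (\<Sum>k<K. \<integral>y. of_bool (real (a i) * t k < y \<and> y \<le> real (a i) * t (Suc k)) * g (y / real (a i)) \<partial>U i)"
    by (rule integral_positive_split[where B = 1]) (use assms B in auto)
  also have "\<dots> = (\<Sum>k<K. (above_prob i (t k) - above_prob i (t (Suc k))) *
       (\<Sum>m<n. kcoef W (t k) (t (Suc k)) i n (int m * W + s) / (real m + 1)))"
  proof (intro sum.cong refl interval_integral)
    fix k :: nat and v :: real assume v: "0 \<le> v" "v \<le> 1"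
    show "g (t k + (t (Suc k) - t k) * v) =
        (\<Sum>m<n. kcoef W (t k) (t (Suc k)) i n (int m * W + s) * v ^ m)"
      using bicoef_poly[OF \<open>i < n\<close> order_refl nb assms(3) v, where s = s] \<open>i < n\<close>
      by (simp add: g_def kcoef_eq_bicoef[OF W])
  qed (use assms in auto)
  finally show ?thesis .
qed

end

section \<open>The follower's solution\<close>

context
  fixes I :: instance_SP and b :: real and c x :: "nat \<Rightarrow> real"
  assumes opt: "x \<in> follower_optimal I b c" and pos: "\<And>i. i < items I \<Longrightarrow> 0 < item_size I i"
begin

text \<open>Optimality as a condition on feasible directions \<open>h\<close>. The following lemmas
  use three of them: dropping an item, adding some of an item, and trading one item for
  another.\<close>

lemma follower_optimal_perturb:
  assumes box: "\<And>i. i < items I \<Longrightarrow> 0 \<le> x i + h i \<and> x i + h i \<le> 1"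
    and cap: "(\<Sum>i<items I. real (item_size I i) * x i) + (\<Sum>i<items I. real (item_size I i) * h i) \<le> b"
  shows "(\<Sum>i<items I. c i * h i) \<le> 0"
proof -
  have "(\<lambda>i. x i + h i) \<in> follower_feasible I b"
    using assms by (simp add: follower_feasible_def algebra_simps sum.distrib)
  then have "(\<Sum>i<items I. c i * (x i + h i)) \<le> (\<Sum>i<items I. c i * x i)"
    using opt unfolding follower_optimal_def by simp
  then show ?thesis
    by (simp add: algebra_simps sum.distrib)
qed

lemma follower_box: "i < items I \<Longrightarrow> 0 \<le> x i" "i < items I \<Longrightarrow> x i \<le> 1"
  and follower_capacity: "(\<Sum>i<items I. real (item_size I i) * x i) \<le> b"
  using opt by (auto simp: follower_optimal_def follower_feasible_def)

lemma follower_negative_value: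
  assumes "i < items I" "c i < 0"
  shows "x i = 0"
proof (rule ccontr)
  assume "x i \<noteq> 0"
  then have "0 < x i"
    using follower_box[OF assms(1)] by simp
  have "(\<Sum>j<items I. c j * (if j = i then - x i else 0)) \<le> 0"
    using assms follower_box \<open>0 < x i\<close> follower_capacity
    by (intro follower_optimal_perturb)
       (auto simp: if_distrib[where f = "\<lambda>z. _ * z"] cong: if_cong intro: order_trans[OF _ follower_capacity])
  then have "c i * x i \<ge> 0"
    using assms by (simp add: if_distrib[where f = "\<lambda>z. _ * z"] cong: if_cong)
  then show False
    using \<open>0 < x i\<close> assms by (simp add: zero_le_mult_iff)
qed

lemma follower_capacity_tight:
  assumes "i < items I" "0 < c i" "x i < 1"
  shows "(\<Sum>j<items I. real (item_size I j) * x j) = b"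
proof (rule ccontr)
  define r where "r = b - (\<Sum>j<items I. real (item_size I j) * x j)"
  \<comment> \<open>The longest step before item \<open>i\<close> is complete or the spare capacity
    \<open>r\<close> is exhausted.\<close>
  define e where "e = min (1 - x i) (r / real (item_size I i))"
  assume "\<not> ?thesis"
  then have r: "0 < r"
    using follower_capacity by (simp add: r_def)
  have a: "0 < real (item_size I i)"
    using pos assms by simp
  have e: "0 < e" "e \<le> 1 - x i" "real (item_size I i) * e \<le> r"
    using r a assms by (auto simp: e_def min_def field_simps)
  have "(\<Sum>j<items I. c j * (if j = i then e else 0)) \<le> 0"
  proof (rule follower_optimal_perturb)
    show "0 \<le> x j + (if j = i then e else 0) \<and> x j + (if j = i then e else 0) \<le> 1" if "j < items I" for j
      using follower_box that e by auto
  qed (use assms e in \<open>simp add: r_def if_distrib[where f = "\<lambda>z. _ * z"] cong: if_cong\<close>)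
  then have "c i * e \<le> 0"
    using assms by (simp add: if_distrib[where f = "\<lambda>z. _ * z"] cong: if_cong)
  then show False
    using e assms by (simp add: mult_le_0_iff)
qed

lemma follower_exchange:
  assumes "i < items I" "j < items I" "c j / item_size I j < c i / item_size I i" "0 < x j"
  shows "x i = 1"
proof (rule ccontr)
  assume "x i \<noteq> 1"
  then have xi: "x i < 1"
    using follower_box[OF assms(1)] by simp
  have "i \<noteq> j"
    using assms(3) by auto
  define p q where "p = real (item_size I i)" and "q = real (item_size I j)"
  have pq: "0 < p" "0 < q"
    using pos assms by (auto simp: p_def q_def)
  \<comment> \<open>\<open>e\<close> is measured in capacity units: the trade keeps the used
    capacity and changes the value by \<open>e * (c i / p - c j / q)\<close>.\<close>
  define e where "e = min ((1 - x i) * p) (x j * q)"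
  have e: "0 < e" "e / p \<le> 1 - x i" "e / q \<le> x j"
    using pq xi assms by (auto simp: e_def min_def field_simps)
  define h where "h = (\<lambda>k. (if k = i then e / p else 0) - (if k = j then e / q else 0))"
  have sum_h: "(\<Sum>k<items I. f k * h k) = f i * (e / p) - f j * (e / q)" for f :: "nat \<Rightarrow> real"
    using assms unfolding h_def right_diff_distrib sum_subtractf
    by (simp add: if_distrib[where f = "\<lambda>z. _ * z"] cong: if_cong)
  have "(\<Sum>k<items I. c k * h k) \<le> 0"
  proof (rule follower_optimal_perturb)
    have "0 \<le> e / p" "0 \<le> e / q"
      using e pq by auto
    then show "0 \<le> x k + h k \<and> x k + h k \<le> 1" if "k < items I" for k
      using follower_box[OF that] e \<open>i \<noteq> j\<close> by (auto simp: h_def)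
    show "(\<Sum>k<items I. real (item_size I k) * x k) + (\<Sum>k<items I. real (item_size I k) * h k) \<le> b"
      unfolding sum_h using follower_capacity pq by (simp add: p_def q_def)
  qed
  then have "e * (c i / p - c j / q) \<le> 0"
    unfolding sum_h by (simp add: algebra_simps)
  then show False
    using e assms by (simp add: p_def q_def mult_le_0_iff)
qed

text \<open>Sandwiches the capacity used by the other items. If \<open>x i < 1\<close>, no item of
  smaller ratio is packed and they use at most \<open>L\<close>; if \<open>x i > 0\<close>, all
  items of larger ratio are full and they use at least \<open>L\<close>. For positive
  \<open>c i\<close>, an incomplete item \<open>i\<close> forces the capacity to be used up.\<close>

lemma follower_optimal_unique:
  assumes i: "i < items I" and "c i \<noteq> 0"
    and ties: "\<And>j. j < items I \<Longrightarrow> j \<noteq> i \<Longrightarrow> c j / item_size I j \<noteq> c i / item_size I i"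
  defines "L \<equiv> (\<Sum>j\<in>{..<items I} - {i}.
      if c i / item_size I i < c j / item_size I j then real (item_size I j) else 0)"
  shows "real (item_size I i) * x i =
    (if 0 < c i then min (real (item_size I i)) (max 0 (b - L)) else 0)"
proof (cases "0 < c i")
  case False
  then show ?thesis
    using follower_negative_value[OF i] \<open>c i \<noteq> 0\<close> by simp
next
  case True
  let ?w = "\<lambda>j. real (item_size I j) * x j"
  let ?J = "{..<items I} - {i}"
  have a: "0 < real (item_size I i)"
    using pos i by simp
  have total: "(\<Sum>j<items I. ?w j) = ?w i + (\<Sum>j\<in>?J. ?w j)"
    using i by (subst sum.remove[of _ i]) auto
  have lower: "(\<Sum>j\<in>?J. ?w j) \<le> L" if "x i < 1"
    unfolding L_def
  proof (intro sum_mono)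
    fix j assume j: "j \<in> ?J"
    show "?w j \<le> (if c i / item_size I i < c j / item_size I j then real (item_size I j) else 0)"
    proof (cases "c i / item_size I i < c j / item_size I j")
      case True
      then show ?thesis
        using j follower_box(2)[of j] by (simp add: mult_left_le)
    next
      case False
      then have "c j / item_size I j < c i / item_size I i"
        using ties[of j] j by auto
      then have "\<not> 0 < x j"
        using follower_exchange[OF i, of j] j that by auto
      then show ?thesis
        using False j follower_box(1)[of j] by simp
    qed
  qed
  have upper: "L \<le> (\<Sum>j\<in>?J. ?w j)" if "0 < x i"
    unfolding L_def
  proof (intro sum_mono)
    fix j assume j: "j \<in> ?J"
    show "(if c i / item_size I i < c j / item_size I j then real (item_size I j) else 0) \<le> ?w j"
      using follower_exchange[of j i] i j that follower_box(1)[of j] by auto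
  qed
  consider "x i = 0" | "0 < x i" "x i < 1" | "x i = 1"
    using follower_box[OF i] by linarith
  then show ?thesis
  proof cases
    case 1
    then have "b \<le> L"
      using lower total follower_capacity_tight[OF i True] by simp
    then show ?thesis
      using 1 True by simp
  next
    case 2
    then have "?w i = b - L"
      using lower upper total follower_capacity_tight[OF i True] by simp
    moreover have "0 \<le> ?w i" "?w i \<le> real (item_size I i)"
      using 2 a by (auto simp: mult_left_le)
    ultimately show ?thesis
      using True by simp
  next
    case 3
    then have "real (item_size I i) \<le> b - L"
      using upper total follower_capacity by simp
    then show ?thesis
      using 3 True a by simp
  qed
qed

end

section \<open>Ties are null events\<close>

context uniform_items
begin

lemma AE_U_neq: "AE y in U i. y \<noteq> z"
  unfolding U_def using bounds[of i] AE_lborel_singleton[of z]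
  by (intro AE_uniform_measureI) auto

text \<open>With the other values fixed, a tie with \<open>j\<close> pins \<open>c i\<close> to a
  single point, which a continuous law charges with 0; Tonelli then gives the claim.\<close>

lemma AE_no_ties:
  assumes "finite N" "i \<in> N"
  shows "AE c in PiM N U. c i \<noteq> 0 \<and> (\<forall>j\<in>N - {i}. c j / real (a j) \<noteq> c i / real (a i))"
proof -
  have "AE c in PiM N U. c i \<noteq> 0"
    by (rule AE_PiM_component) (use assms prob_space_U AE_U_neq in auto)
  moreover have "AE c in PiM N U. c j / real (a j) \<noteq> c i / real (a i)" if j: "j \<in> N - {i}" for j
  proof -
    define J where "J = N - {i}"
    have N: "N = insert i J" "finite J" "i \<notin> J" "j \<in> J"
      using assms j by (auto simp: J_def)
    have [measurable]: "(\<lambda>c. c i) \<in> borel_measurable (PiM N U)" "(\<lambda>c. c j) \<in> borel_measurable (PiM N U)"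
      using assms j measurable_component_singleton[of i N U] measurable_component_singleton[of j N U] by auto
    have meas: "{c \<in> space (PiM N U). c j / real (a j) = c i / real (a i)} \<in> sets (PiM N U)"
      by measurable
    let ?f = "\<lambda>c. indicator {c \<in> space (PiM N U). c j / real (a j) = c i / real (a i)} c :: ennreal"
    have "emeasure (PiM N U) {c \<in> space (PiM N U). c j / real (a j) = c i / real (a i)} = (\<integral>\<^sup>+c. ?f c \<partial>PiM N U)"
      using meas by simp
    also have "\<dots> = (\<integral>\<^sup>+x. (\<integral>\<^sup>+y. ?f (x(i := y)) \<partial>U i) \<partial>PiM J U)"
      unfolding N(1) using meas by (intro U.product_nn_integral_insert N) (simp add: N(1))
    also have "\<dots> = (\<integral>\<^sup>+x. 0 \<partial>PiM J U)"
    proof (intro nn_integral_cong)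
      fix x
      have "AE y in U i. ?f (x(i := y)) = 0"
        using AE_U_neq[of "x j / real (a j) * real (a i)" i]
      proof eventually_elim
        case (elim y)
        then show ?case
          using size_pos[of i] size_pos[of j] j by (auto simp: indicator_def field_simps)
      qed
      then have "(\<integral>\<^sup>+y. ?f (x(i := y)) \<partial>U i) = (\<integral>\<^sup>+y. 0 \<partial>U i)"
        by (rule nn_integral_cong_AE)
      then show "(\<integral>\<^sup>+y. ?f (x(i := y)) \<partial>U i) = 0"
        by simp
    qed
    finally show ?thesis
      using meas by (intro AE_I[of _ _ "{c \<in> space (PiM N U). c j / real (a j) = c i / real (a i)}"]) auto
  qed
  ultimately show ?thesis
    using assms by (auto simp: AE_finite_all eventually_conj_iff)
qed

end

text \<open>Applies to an arbitrary response: \<open>f\<close> inherits measurability on the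
  completion from agreeing almost everywhere with \<open>g\<close>.\<close>

lemma integral_completion_cong_AE:
  fixes f g :: "'a \<Rightarrow> real"
  assumes g: "g \<in> borel_measurable M" and ae: "AE x in M. f x = g x"
  shows "integral\<^sup>L (completion M) f = integral\<^sup>L M g"
proof -
  have ae': "AE x in completion M. f x = g x"
    using ae by (rule AE_completion)
  have g': "g \<in> borel_measurable (completion M)"
    using g by (rule measurable_completion)
  have "f \<in> borel_measurable (completion M)"
  proof (rule measurableI)
    fix A :: "real set" assume A: "A \<in> sets borel"
    show "f -` A \<inter> space (completion M) \<in> sets (completion M)"
    proof (rule completion.in_sets_AE)
      show "g -` A \<inter> space (completion M) \<in> sets (completion M)"
        using g' A by (rule measurable_sets)
      show "AE x in completion M. (x \<in> g -` A \<inter> space (completion M)) = (x \<in> f -` A \<inter> space (completion M))"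
        using ae' by eventually_elim auto
    qed auto
  qed auto
  then have "integral\<^sup>L (completion M) f = integral\<^sup>L (completion M) g"
    using g' ae' by (intro integral_cong_AE)
  then show ?thesis
    using g by (simp add: integral_completion)
qed

section \<open>The expected objective\<close>

text \<open>\<open>clamp01 (b - v)\<close> is the part of the unit slot from \<open>v\<close> to
  \<open>v + 1\<close> lying below capacity \<open>b\<close>. These ramps form a basis in which the
  objective is expanded.\<close>

definition clamp01 :: "real \<Rightarrow> real" where
  "clamp01 y = min 1 (max 0 y)"

text \<open>An item of size \<open>a\<close> preceded by load \<open>L\<close> owns the slots
  \<open>L..<L + a\<close>; its packed amount is what is filled of them.\<close>

lemma sum_clamp01_window:
  "(\<Sum>v\<in>{L..<L + a}. clamp01 (b - real v)) = min (real a) (max 0 (b - real L))"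
proof (induction a)
  case (Suc a)
  have "(\<Sum>v\<in>{L..<L + Suc a}. clamp01 (b - real v)) = min (real a) (max 0 (b - real L)) + clamp01 (b - real (L + a))"
    using Suc by simp
  also have "\<dots> = min (real (Suc a)) (max 0 (b - real L))"
    by (auto simp: clamp01_def min_def max_def)
  finally show ?case .
qed simp

lemma sum_clamp01:
  assumes "0 \<le> b" "b \<le> real A"
  shows "(\<Sum>v<A. clamp01 (b - real v)) = b"
  using sum_clamp01_window[where L = 0 and a = A and b = b] assms by (simp add: atLeast0LessThan)

text \<open>The discrete derivative of the window is +1 at \<open>L\<close> and -1 at
  \<open>L + a\<close>. This is the origin of the factor \<open>1 - x^(a i)\<close>.\<close>

lemma sum_window_jumps:
  fixes L a v :: nat
  assumes "0 < a"
  shows "(\<Sum>s<Suc v. of_bool (real L = of_int (int s)) - of_bool (real L = of_int (int s - int a))) =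
    (of_bool (L \<le> v \<and> v < L + a) :: real)"
proof -
  have "(\<Sum>s<Suc v. of_bool (real L = of_int (int s)) :: real) = (\<Sum>s<Suc v. if s = L then 1 else 0)"
    by (intro sum.cong) auto
  moreover have "(\<Sum>s<Suc v. of_bool (real L = of_int (int s - int a)) :: real) = (\<Sum>s<Suc v. if s = L + a then 1 else 0)"
    by (intro sum.cong) auto
  ultimately show ?thesis
    using assms by (simp only: sum_subtractf) auto
qed

context uniform_items
begin

lemma expected_share:
  assumes "i < n"
  defines "J \<equiv> {..<n} - {i}"
  shows "(\<integral>c. (if 0 < c i then min (real (a i)) (max 0 (b - load J (c i / real (a i)) c)) else 0) \<partial>PiM {..<n} U) =
    (\<Sum>v<(\<Sum>j<n. a j). clamp01 (b - real v) *
      (\<Sum>s<Suc v. crit_prob i J (int s) - crit_prob i J (int s - int (a i))))" (is "?L = ?R")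
    and "(\<lambda>c. if 0 < c i then min (real (a i)) (max 0 (b - load J (c i / real (a i)) c)) else 0)
      \<in> borel_measurable (PiM {..<n} U)"
    and "integrable (PiM {..<n} U)
      (\<lambda>c. if 0 < c i then min (real (a i)) (max 0 (b - load J (c i / real (a i)) c)) else 0)"
proof -
  have N: "{..<n} = insert i J"
    using assms by auto
  define A where "A = (\<Sum>j<n. a j)"
  define q where "q = (\<lambda>s c. of_bool (0 < c i \<and> load J (c i / real (a i)) c = of_int s) :: real)"
  have q_meas: "q s \<in> borel_measurable (PiM {..<n} U)" for s
    unfolding q_def N by (rule crit_measurable)
  have q_int: "integrable (PiM {..<n} U) (q s)" for s
    by (rule integrable_PiM_bounded[OF q_meas, where B = 1]) (auto simp: q_def)
  have q_crit: "(\<integral>c. q s c \<partial>PiM {..<n} U) = crit_prob i J s" for s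
    unfolding crit_prob_def q_def N ..
  \<comment> \<open>Pointwise, the packed amount is a finite linear combination of the indicators
    \<open>q s\<close>; measurability, integrability and the expectation all follow by
    linearity.\<close>
  have eq: "(if 0 < c i then min (real (a i)) (max 0 (b - load J (c i / real (a i)) c)) else 0) =
      (\<Sum>v<A. clamp01 (b - real v) * (\<Sum>s<Suc v. q (int s) c - q (int s - int (a i)) c))" for c
  proof (cases "0 < c i")
    case False
    then show ?thesis by (simp add: q_def)
  next
    case True
    define L where "L = (\<Sum>j\<in>J. if real (a j) * (c i / real (a i)) < c j then a j else 0)"
    have L: "load J (c i / real (a i)) c = real L"
      unfolding load_def L_def of_nat_sum by (intro sum.cong) auto
    have "L \<le> (\<Sum>j\<in>J. a j)"
      unfolding L_def by (intro sum_mono) auto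
    then have le: "L + a i \<le> A"
      using assms by (simp add: A_def sum.remove[of "{..<n}" i])
    have "(\<Sum>v<A. clamp01 (b - real v) * (\<Sum>s<Suc v. q (int s) c - q (int s - int (a i)) c)) =
        (\<Sum>v<A. clamp01 (b - real v) * of_bool (L \<le> v \<and> v < L + a i))"
      unfolding q_def L using True sum_window_jumps[OF size_pos] by simp
    also have "\<dots> = (\<Sum>v\<in>{L..<L + a i}. clamp01 (b - real v))"
      using le by (intro sum.mono_neutral_cong_right) auto
    finally show ?thesis
      using True by (simp add: L sum_clamp01_window)
  qed
  show "(\<lambda>c. if 0 < c i then min (real (a i)) (max 0 (b - load J (c i / real (a i)) c)) else 0)
      \<in> borel_measurable (PiM {..<n} U)"
    unfolding eq using q_meas by (intro borel_measurable_sum borel_measurable_times borel_measurable_diff) auto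
  show "integrable (PiM {..<n} U)
      (\<lambda>c. if 0 < c i then min (real (a i)) (max 0 (b - load J (c i / real (a i)) c)) else 0)"
    unfolding eq using q_int by auto
  show "?L = ?R"
    unfolding eq using q_int by (simp add: q_crit A_def)
qed

end

section \<open>Break points and the explicit piecewise linear objective\<close>

locale valid_SP =
  fixes I :: instance_SP
  assumes valid: "valid_instance I"
begin

abbreviation n :: nat where "n \<equiv> items I"
abbreviation A :: nat where "A \<equiv> total_size I"

text \<open>Off-range indices get dummy data, so that every component of the product measure is a
  probability measure.\<close>

definition a :: "nat \<Rightarrow> nat" where "a j = (if j < n then item_size I j else 1)"
definition l :: "nat \<Rightarrow> real" where "l j = (if j < n then c_lower I j else 0)"
definition u :: "nat \<Rightarrow> real" where "u j = (if j < n then c_upper I j else 1)"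

sublocale uniform_items a l u
  by unfold_locales (use valid in \<open>auto simp: valid_instance_def a_def l_def u_def\<close>)

lemma A_eq: "A = (\<Sum>j<n. a j)"
  by (simp add: total_size_def a_def)

lemma b_range: "0 \<le> b_lower I" "b_lower I \<le> b_upper I" "b_upper I \<le> real A" and n_pos: "0 < n"
  using valid by (auto simp: valid_instance_def)

definition breaks :: "real set" where
  "breaks = (\<lambda>j. l j / real (a j)) ` {..<n} \<union> (\<lambda>j. u j / real (a j)) ` {..<n}"

text \<open>Stays put after the last break. The remaining intervals are then degenerate and get
  weight 0, so a fixed number \<open>2 * n\<close> of rounds works without counting distinct
  breaks.\<close>

definition next_break :: "real \<Rightarrow> real" where
  "next_break t = (if \<exists>q\<in>breaks. t < q then Min {q \<in> breaks. t < q} else t)"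

definition brk :: "nat \<Rightarrow> real" where
  "brk k = (next_break ^^ k) 0"

lemma brk_simps [simp]: "brk 0 = 0" "brk (Suc k) = next_break (brk k)"
  by (simp_all add: brk_def)

lemma finite_breaks: "finite breaks"
  by (simp add: breaks_def)

lemma card_breaks: "card breaks \<le> 2 * n"
proof -
  have "card breaks \<le> card ((\<lambda>j. l j / real (a j)) ` {..<n}) + card ((\<lambda>j. u j / real (a j)) ` {..<n})"
    unfolding breaks_def by (rule card_Un_le)
  also have "\<dots> \<le> card {..<n} + card {..<n}"
    by (intro add_mono card_image_le) auto
  finally show ?thesis by simp
qed

lemma next_break_cases:
  obtains (last) "next_break t = t" "\<And>q. q \<in> breaks \<Longrightarrow> q \<le> t"
    | (step) "t < next_break t" "next_break t \<in> breaks" "\<And>q. q \<in> breaks \<Longrightarrow> t < q \<Longrightarrow> next_break t \<le> q"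
proof (cases "\<exists>q\<in>breaks. t < q")
  case True
  have fin: "finite {q \<in> breaks. t < q}"
    using finite_breaks by simp
  have "{q \<in> breaks. t < q} \<noteq> {}"
    using True by auto
  then have "Min {q \<in> breaks. t < q} \<in> {q \<in> breaks. t < q}"
    using fin by (rule Min_in[rotated])
  with fin True step show ?thesis
    by (auto simp: next_break_def)
next
  case False
  with last show ?thesis
    by (force simp: next_break_def)
qed

text \<open>Shaped after what the scan in \<open>find_next\<close> has established when it
  ends.\<close>

lemma next_break_eqI:
  assumes "t \<le> r" "r = t \<or> r \<in> breaks" "\<And>q. q \<in> breaks \<Longrightarrow> t < q \<Longrightarrow> t < r \<and> r \<le> q"
  shows "r = next_break t"
  by (cases t rule: next_break_cases) (use assms in \<open>force+\<close>)

lemma brk_le_Suc: "brk k \<le> brk (Suc k)"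
  by (cases "brk k" rule: next_break_cases) auto

lemma no_break_brk:
  assumes "j < n" shows "no_break (brk k) (brk (Suc k)) j"
proof -
  have "l j / real (a j) \<in> breaks" "u j / real (a j) \<in> breaks"
    using assms by (auto simp: breaks_def)
  then show ?thesis
    unfolding no_break_def
    by (cases "brk k" rule: next_break_cases) force+
qed

text \<open>Every proper step leaves at least one of the at most \<open>2 * n\<close> breaks behind;
  a step that stands still means that none lies above.\<close>

lemma breaks_above_brk: "card {q \<in> breaks. brk k < q} \<le> 2 * n - k"
proof (induction k)
  case 0
  have "card {q \<in> breaks. brk 0 < q} \<le> card breaks"
    using finite_breaks by (intro card_mono) auto
  then show ?case
    using card_breaks by simp
next
  case (Suc k)
  show ?case
  proof (cases "brk k" rule: next_break_cases)
    case last
    then have "{q \<in> breaks. brk (Suc k) < q} = {}"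
      by force
    then show ?thesis
      by (simp only: card.empty)
  next
    case step
    have "{q \<in> breaks. brk (Suc k) < q} \<subset> {q \<in> breaks. brk k < q}"
      using step by force
    then have "card {q \<in> breaks. brk (Suc k) < q} < card {q \<in> breaks. brk k < q}"
      using finite_breaks by (intro psubset_card_mono) auto
    then show ?thesis
      using Suc by simp
  qed
qed

lemma u_le_last_brk:
  assumes "i < n" shows "u i \<le> real (a i) * brk (2 * n)"
proof -
  have "{q \<in> breaks. brk (2 * n) < q} = {}"
    using breaks_above_brk[of "2 * n"] finite_breaks by simp
  then have "u i / real (a i) \<le> brk (2 * n)"
    using assms by (force simp: breaks_def)
  then show ?thesis
    using size_pos[of i] by (simp add: field_simps)
qed

text \<open>Sizes range from 0 to \<open>A\<close>, so \<open>A + 1\<close> is the least base that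
  avoids carries.\<close>

definition W :: int where "W = int A + 1"

definition weight :: "nat \<Rightarrow> nat \<Rightarrow> real" where
  "weight k i = of_int (leader_value I i) / real (a i) * (above_prob i (brk k) - above_prob i (brk (Suc k)))"

text \<open>The expression that the program accumulates, as opposed to its probabilistic meaning,
  which \<open>jump_eq\<close> supplies: the contribution at \<open>s\<close> to the change of
  slope.\<close>

definition jump :: "nat \<Rightarrow> real" where
  "jump s = (\<Sum>k<2 * n. \<Sum>i<n. weight k i *
     (\<Sum>m<n. kcoef W (brk k) (brk (Suc k)) i n (int m * W + int s) / (real m + 1)))"

definition slope :: "nat \<Rightarrow> real" where
  "slope v = (\<Sum>s<Suc v. jump s) - unit_price I"

definition objective :: "real \<Rightarrow> real" where
  "objective b = (\<Sum>v<A. slope v * clamp01 (b - real v))"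

lemma jump_eq:
  assumes "s \<le> A"
  shows "jump s = (\<Sum>i<n. of_int (leader_value I i) / real (a i) *
    (crit_prob i ({..<n} - {i}) (int s) - crit_prob i ({..<n} - {i}) (int s - int (a i))))"
proof -
  have "of_int (leader_value I i) / real (a i) *
      (crit_prob i ({..<n} - {i}) (int s) - crit_prob i ({..<n} - {i}) (int s - int (a i))) =
    (\<Sum>k<2 * n. weight k i *
      (\<Sum>m<n. kcoef W (brk k) (brk (Suc k)) i n (int m * W + int s) / (real m + 1)))" if "i < n" for i
    by (subst crit_prob_diff[of i n brk "2 * n" W])
       (use that assms brk_le_Suc u_le_last_brk no_break_brk A_eq in
         \<open>auto simp: weight_def sum_distrib_left mult.assoc W_def simp del: brk_simps(2) of_nat_sum\<close>)
  then show ?thesis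
    unfolding jump_def by (subst sum.swap) simp
qed

text \<open>The right-hand side does not mention \<open>x\<close>: almost surely optimality forces
  the packed amount of item \<open>i\<close> to be \<open>sh i c\<close>, whatever the
  response.\<close>

lemma leader_objective_eq:
  assumes resp: "follower_response I x" and b: "b \<in> {b_lower I..b_upper I}"
  shows "leader_objective I x b = objective b"
proof -
  let ?J = "\<lambda>i. {..<n} - {i}"
  let ?d = "\<lambda>i. real_of_int (leader_value I i)"
  define sh where "sh = (\<lambda>i c. if 0 < c i then min (real (a i)) (max 0 (b - load (?J i) (c i / real (a i)) c)) else 0)"
  define g where "g = (\<lambda>c. (\<Sum>i<n. ?d i / real (a i) * sh i c) - unit_price I * b)"
  interpret P: prob_space "PiM {..<n} U"
    by (rule prob_space_PiM_U)
  have law: "value_law I = completion (PiM {..<n} U)"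
    unfolding value_law_def U_def by (intro arg_cong[where f = completion] PiM_cong) (auto simp: l_def u_def)
  have sh_meas: "sh i \<in> borel_measurable (PiM {..<n} U)" and sh_int: "integrable (PiM {..<n} U) (sh i)"
    and sh_exp: "(\<integral>c. sh i c \<partial>PiM {..<n} U) = (\<Sum>v<A. clamp01 (b - real v) *
      (\<Sum>s<Suc v. crit_prob i (?J i) (int s) - crit_prob i (?J i) (int s - int (a i))))" if "i < n" for i
    using expected_share[OF that] unfolding sh_def A_eq by auto
  have "AE c in PiM {..<n} U. \<forall>i\<in>{..<n}. c i \<noteq> 0 \<and> (\<forall>j\<in>{..<n} - {i}. c j / real (a j) \<noteq> c i / real (a i))"
    by (intro AE_finite_allI AE_no_ties) auto
  then have ae: "AE c in PiM {..<n} U. (\<Sum>i<n. ?d i * x b c i) - unit_price I * b = g c"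
  proof eventually_elim
    case (elim c)
    have opt: "x b c \<in> follower_optimal I b c"
      using resp b unfolding follower_response_def by auto
    have pos: "\<And>i. i < n \<Longrightarrow> 0 < item_size I i"
      using valid by (simp add: valid_instance_def)
    have "real (a i) * x b c i = sh i c" if i: "i < n" for i
    proof -
      have "load (?J i) (c i / real (a i)) c =
          (\<Sum>j\<in>?J i. if c i / item_size I i < c j / item_size I j then real (item_size I j) else 0)"
        unfolding load_def
      proof (intro sum.cong refl)
        fix j assume "j \<in> ?J i"
        then have "a j = item_size I j" "a i = item_size I i"
          using i by (auto simp: a_def)
        then show "(if real (a j) * (c i / real (a i)) < c j then real (a j) else 0) =
            (if c i / item_size I i < c j / item_size I j then real (item_size I j) else 0)"
          using size_pos[of j] by (simp add: less_divide_eq mult.commute)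
      qed
      then show ?thesis
        using follower_optimal_unique[OF opt pos i] elim i by (auto simp: sh_def a_def)
    qed
    then have "?d i * x b c i = ?d i / real (a i) * sh i c" if "i < n" for i
      using that size_pos[of i] by (simp add: field_simps)
    then show ?case
      by (simp add: g_def)
  qed
  have "leader_objective I x b = (\<integral>c. g c \<partial>PiM {..<n} U)"
    unfolding leader_objective_def law
    by (rule integral_completion_cong_AE[OF _ ae]) (use sh_meas in \<open>auto simp: g_def\<close>)
  also have "\<dots> = (\<Sum>i<n. ?d i / real (a i) * (\<integral>c. sh i c \<partial>PiM {..<n} U)) - unit_price I * b"
  proof -
    have "integrable (PiM {..<n} U) (\<lambda>c. \<Sum>i<n. ?d i / real (a i) * sh i c)"
      by (intro Bochner_Integration.integrable_sum integrable_mult_right sh_int) auto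
    moreover have "(\<integral>c. (\<Sum>i<n. ?d i / real (a i) * sh i c) \<partial>PiM {..<n} U) =
        (\<Sum>i<n. ?d i / real (a i) * (\<integral>c. sh i c \<partial>PiM {..<n} U))"
      by (subst Bochner_Integration.integral_sum) (use sh_int in auto)
    ultimately show ?thesis
      unfolding g_def by (simp add: P.prob_space)
  qed
  also have "(\<Sum>i<n. ?d i / real (a i) * (\<integral>c. sh i c \<partial>PiM {..<n} U)) =
      (\<Sum>i<n. \<Sum>v<A. \<Sum>s<Suc v. clamp01 (b - real v) * (?d i / real (a i) *
        (crit_prob i (?J i) (int s) - crit_prob i (?J i) (int s - int (a i)))))"
    using sh_exp by (simp add: sum_distrib_left mult_ac del: sum.lessThan_Suc)
  also have "\<dots> = (\<Sum>v<A. \<Sum>s<Suc v. \<Sum>i<n. clamp01 (b - real v) * (?d i / real (a i) *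
        (crit_prob i (?J i) (int s) - crit_prob i (?J i) (int s - int (a i)))))"
    by (subst sum.swap) (rule sum.cong[OF refl sum.swap])
  also have "\<dots> = (\<Sum>v<A. clamp01 (b - real v) * (\<Sum>s<Suc v. jump s))"
    unfolding sum_distrib_left[symmetric]
    by (intro sum.cong refl arg_cong2[where f = "(*)"] jump_eq[symmetric]) auto
  \<comment> \<open>Since \<open>b\<close> lies between 0 and \<open>A\<close>, the price too is
    spread over the unit slots and lowers every slope by the same constant.\<close>
  also have "unit_price I * b = (\<Sum>v<A. clamp01 (b - real v) * unit_price I)"
    using sum_clamp01[of b A] b b_range by (simp flip: sum_distrib_right)
  finally show ?thesis
    unfolding objective_def slope_def by (simp add: sum_subtractf left_diff_distrib right_diff_distrib mult.commute del: sum.lessThan_Suc)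
qed

end

section \<open>The program\<close>

definition init_sizes :: com where
  "init_sizes = Seq
     (For ''j'' ''n'' (ISet ''A'' (IAdd (IVar ''A'') (ICell ''a'' (IVar ''j'')))))
     (Seq (ISet ''W'' (IAdd (IVar ''A'') (IConst 1)))
     (Seq (ISet ''N'' (IMul (IVar ''n'') (IVar ''W'')))
          (ISet ''K'' (IMul (IConst 2) (IVar ''n'')))))"

text \<open>\<open>be\<close> is the best candidate so far for the break after \<open>al\<close>;
  \<open>be = al\<close> encodes that none has been found.\<close>

definition relax :: "rexp \<Rightarrow> com" where
  "relax e = Seq (RSet ''x'' e)
     (Cond (BAnd (BNot (RLe (RVar ''x'') (RVar ''al'')))
                 (BNot (BAnd (BNot (RLe (RVar ''be'') (RVar ''al''))) (RLe (RVar ''be'') (RVar ''x'')))))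
       (RSet ''be'' (RVar ''x'')) Skip)"

definition find_next :: com where
  "find_next = For ''j'' ''n'' (Seq
     (relax (RDiv (RCell ''c_lower'' (IVar ''j'')) (ROfInt (ICell ''a'' (IVar ''j'')))))
     (relax (RDiv (RCell ''c_upper'' (IVar ''j'')) (ROfInt (ICell ''a'' (IVar ''j''))))))"

definition set_prob :: "string \<Rightarrow> string \<Rightarrow> com" where
  "set_prob D T = Seq
     (RAssign D (IVar ''j'')
       (RDiv (RSub (RCell ''c_upper'' (IVar ''j'')) (RMul (ROfInt (ICell ''a'' (IVar ''j''))) (RVar T)))
             (RSub (RCell ''c_upper'' (IVar ''j'')) (RCell ''c_lower'' (IVar ''j'')))))
     (Seq
       (Cond (RLe (RCell D (IVar ''j'')) (ROfInt (IConst 0))) (RAssign D (IVar ''j'') (ROfInt (IConst 0))) Skip)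
       (Cond (RLe (ROfInt (IConst 1)) (RCell D (IVar ''j''))) (RAssign D (IVar ''j'') (ROfInt (IConst 1))) Skip))"

definition find_probs :: com where
  "find_probs = For ''j'' ''n'' (Seq (set_prob ''pa'' ''al'') (set_prob ''pb'' ''be''))"

definition reset_poly :: com where
  "reset_poly = Seq (For ''q'' ''N'' (RAssign ''P'' (IVar ''q'') (ROfInt (IConst 0))))
     (RSet ''P'' (ROfInt (IConst 1)))"

definition set_factor :: com where
  "set_factor = Cond (BAnd (ILe (IVar ''j'') (IVar ''i'')) (ILe (IVar ''i'') (IVar ''j'')))
     (Seq (RSet ''x0'' (ROfInt (IConst 1))) (Seq (RSet ''x1'' (ROfInt (IConst 0)))
       (Seq (RSet ''x2'' (ROfInt (IConst (-1)))) (RSet ''x3'' (ROfInt (IConst 0))))))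
     (Seq (RSet ''x0'' (RSub (ROfInt (IConst 1)) (RCell ''pa'' (IVar ''j''))))
       (Seq (RSet ''x1'' (RSub (RCell ''pa'' (IVar ''j'')) (RCell ''pb'' (IVar ''j''))))
         (Seq (RSet ''x2'' (RCell ''pa'' (IVar ''j'')))
              (RSet ''x3'' (RSub (RCell ''pb'' (IVar ''j'')) (RCell ''pa'' (IVar ''j'')))))))"

text \<open>The coefficients are overwritten from the highest exponent downwards, so every coefficient that is
  read still belongs to the old polynomial.\<close>

definition mult_factor :: com where
  "mult_factor = For ''q'' ''N'' (Seq
     (ISet ''z'' (ISub (ISub (IVar ''N'') (IConst 1)) (IVar ''q'')))
     (RAssign ''P'' (IVar ''z'')
       (RAdd (RAdd (RAdd (RMul (RVar ''x0'') (RCell ''P'' (IVar ''z'')))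
         (RMul (RVar ''x1'') (RCell ''P'' (ISub (IVar ''z'') (IVar ''W'')))))
         (RMul (RVar ''x2'') (RCell ''P'' (ISub (IVar ''z'') (ICell ''a'' (IVar ''j''))))))
         (RMul (RVar ''x3'') (RCell ''P'' (ISub (ISub (IVar ''z'') (IVar ''W'')) (ICell ''a'' (IVar ''j''))))))))"

definition build_poly :: com where
  "build_poly = For ''j'' ''n'' (Seq set_factor mult_factor)"

definition set_weight :: com where
  "set_weight = RSet ''w''
     (RMul (RDiv (ROfInt (ICell ''d'' (IVar ''i''))) (ROfInt (ICell ''a'' (IVar ''i''))))
           (RSub (RCell ''pa'' (IVar ''i'')) (RCell ''pb'' (IVar ''i''))))"

text \<open>Row \<open>m\<close> of the polynomial carries \<open>v^m\<close>; dividing by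
  \<open>m + 1\<close> integrates it over [0, 1].\<close>

definition accumulate :: com where
  "accumulate = For ''m'' ''n'' (For ''v'' ''A''
     (RAssign ''H'' (IVar ''v'') (RAdd (RCell ''H'' (IVar ''v''))
       (RMul (RVar ''w'')
         (RDiv (RCell ''P'' (IAdd (IMul (IVar ''m'') (IVar ''W'')) (IVar ''v'')))
               (RAdd (ROfInt (IVar ''m'')) (ROfInt (IConst 1))))))))"

definition all_items :: com where
  "all_items = For ''i'' ''n'' (Seq reset_poly (Seq build_poly (Seq set_weight accumulate)))"

definition all_intervals :: com where
  "all_intervals = For ''k'' ''K''
     (Seq (RSet ''be'' (RVar ''al''))
     (Seq find_next
     (Seq find_probs
     (Seq all_items
          (RSet ''al'' (RVar ''be''))))))"

text \<open>The objective at \<open>b_lower\<close> is known only after all slots have been scanned: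
  \<open>base\<close> collects it, while \<open>cur\<close> and \<open>best\<close> are measured
  relative to it. One pass thus serves both purposes, and \<open>value\<close> adds the two
  parts.\<close>

definition search_step :: com where
  "search_step =
     Seq (RSet ''r'' (RAdd (RVar ''r'') (RCell ''H'' (IVar ''v''))))
     (Seq (RSet ''sl'' (RSub (RVar ''r'') (RVar ''delta'')))
     (Seq (RSet ''x'' (RSub (RVar ''b_lower'') (ROfInt (IVar ''v''))))
     (Seq (Cond (RLe (RVar ''x'') (ROfInt (IConst 0))) (RSet ''x'' (ROfInt (IConst 0))) Skip)
     (Seq (Cond (RLe (ROfInt (IConst 1)) (RVar ''x'')) (RSet ''x'' (ROfInt (IConst 1))) Skip)
     (Seq (RSet ''base'' (RAdd (RVar ''base'') (RMul (RVar ''sl'') (RVar ''x''))))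
     (Seq (RSet ''hi'' (ROfInt (IAdd (IVar ''v'') (IConst 1))))
     (Seq (Cond (RLe (RVar ''hi'') (RVar ''b_lower'')) (RSet ''hi'' (RVar ''b_lower'')) Skip)
     (Seq (Cond (RLe (RVar ''b_upper'') (RVar ''hi'')) (RSet ''hi'' (RVar ''b_upper'')) Skip)
     (Seq (RSet ''cur'' (RAdd (RVar ''cur'') (RMul (RVar ''sl'') (RSub (RVar ''hi'') (RVar ''lo'')))))
     (Seq (RSet ''lo'' (RVar ''hi''))
          (Cond (RLe (RVar ''cur'') (RVar ''best'')) Skip
            (Seq (RSet ''best'' (RVar ''cur'')) (RSet ''b'' (RVar ''hi''))))))))))))))"

definition search :: com where
  "search = Seq (RSet ''lo'' (RVar ''b_lower'')) (Seq (RSet ''b'' (RVar ''b_lower''))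
     (Seq (For ''v'' ''A'' search_step)
          (RSet ''value'' (RAdd (RVar ''base'') (RVar ''best'')))))"

definition solver :: com where
  "solver = Seq init_sizes (Seq all_intervals search)"

lemma loop_writes [simp]:
  "iwrites init_sizes = {''j'', ''A'', ''W'', ''N'', ''K''}" "rwrites init_sizes = {}"
  "iwrites find_next = {''j''}" "rwrites find_next = {''x'', ''be''}"
  "iwrites find_probs = {''j''}" "rwrites find_probs = {''pa'', ''pb''}"
  "iwrites reset_poly = {''q''}" "rwrites reset_poly = {''P''}"
  "iwrites set_factor = {}" "rwrites set_factor = {''x0'', ''x1'', ''x2'', ''x3''}"
  "iwrites mult_factor = {''q'', ''z''}" "rwrites mult_factor = {''P''}"
  "iwrites build_poly = {''j'', ''q'', ''z''}" "rwrites build_poly = {''x0'', ''x1'', ''x2'', ''x3'', ''P''}"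
  "iwrites set_weight = {}" "rwrites set_weight = {''w''}"
  "iwrites accumulate = {''m'', ''v''}" "rwrites accumulate = {''H''}"
  "iwrites all_items = {''i'', ''q'', ''j'', ''z'', ''m'', ''v''}"
  "rwrites all_items = {''P'', ''x0'', ''x1'', ''x2'', ''x3'', ''w'', ''H''}"
  "iwrites all_intervals = {''k'', ''i'', ''q'', ''j'', ''z'', ''m'', ''v''}"
  "rwrites all_intervals = {''al'', ''be'', ''x'', ''pa'', ''pb'', ''P'', ''x0'', ''x1'', ''x2'', ''x3'', ''w'', ''H''}"
  by (auto simp: init_sizes_def find_next_def relax_def find_probs_def set_prob_def reset_poly_def
      set_factor_def mult_factor_def build_poly_def set_weight_def accumulate_def all_items_def all_intervals_def)

section \<open>Correctness and running time of the program\<close>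

context valid_SP
begin

text \<open>Lets terms linear in \<open>n\<close> be absorbed into \<open>n ^ 4 * A\<close>.\<close>

lemma A_ge_n: "n \<le> A"
proof -
  have "(\<Sum>j<n. 1) \<le> (\<Sum>j<n. a j)"
    using size_pos by (intro sum_mono) (simp add: Suc_le_eq)
  then show ?thesis by (simp add: A_eq)
qed

lemma A_pos: "0 < A"
  using A_ge_n n_pos by simp

definition N :: nat where "N = n * (A + 1)"

lemma N_pos: "0 < N" and A_le_N: "A \<le> N" and N_le: "N \<le> 2 * (n * A)"
proof -
  show "0 < N"
    using n_pos by (simp add: N_def)
  show "A \<le> N"
    using mult_le_mono1[of 1 n "A + 1"] n_pos by (simp add: N_def)
  show "N \<le> 2 * (n * A)"
    using A_pos by (simp add: N_def)
qed

lemma N_eq: "int N = int n * W"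
  by (simp add: N_def W_def algebra_simps)

definition holds_instance :: "memory \<Rightarrow> bool" where
  "holds_instance s \<longleftrightarrow>
     icells s ''n'' 0 = int n \<and>
     (\<forall>j<n. icells s ''a'' (int j) = int (a j)) \<and>
     (\<forall>j<n. icells s ''d'' (int j) = leader_value I j) \<and>
     (\<forall>j<n. rcells s ''c_lower'' (int j) = l j) \<and>
     (\<forall>j<n. rcells s ''c_upper'' (int j) = u j) \<and>
     rcells s ''delta'' 0 = unit_price I \<and>
     rcells s ''b_lower'' 0 = b_lower I \<and>
     rcells s ''b_upper'' 0 = b_upper I"

definition prepared :: "memory \<Rightarrow> bool" where
  "prepared s \<longleftrightarrow> holds_instance s \<and> icells s ''A'' 0 = int A \<and> icells s ''W'' 0 = W \<and>
     icells s ''N'' 0 = int N \<and> icells s ''K'' 0 = int (2 * n)"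

text \<open>Together with \<open>fixed_rnames\<close>, the arrays that no phase after
  \<open>init_sizes\<close> writes; \<open>prepared\<close> depends on these alone.\<close>

definition fixed_inames :: "string set" where
  "fixed_inames = {''n'', ''a'', ''d'', ''A'', ''W'', ''N'', ''K''}"

definition fixed_rnames :: "string set" where
  "fixed_rnames = {''c_lower'', ''c_upper'', ''delta'', ''b_lower'', ''b_upper''}"

lemma prepared_unchanged:
  assumes "prepared s" "unchanged p s s'" "iwrites p \<inter> fixed_inames = {}" "rwrites p \<inter> fixed_rnames = {}"
  shows "prepared s'"
proof -
  have "icells s' X = icells s X" if "X \<in> fixed_inames" for X
    using that assms unfolding unchanged_def by blast
  moreover have "rcells s' X = rcells s X" if "X \<in> fixed_rnames" for X
    using that assms unfolding unchanged_def by blast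
  ultimately show ?thesis
    using assms(1) by (simp add: prepared_def holds_instance_def fixed_inames_def fixed_rnames_def)
qed

lemma runs_init_sizes:
  assumes "holds_instance s" "icells s ''A'' 0 = 0"
  shows "runs init_sizes s (n * 123 + 100) prepared"
proof -
  \<comment> \<open>Here and below, 100, 200 and 300 are round bounds for the cost of straight-line
    code; a loop adds 23 per round.\<close>
  have "runs (For ''j'' ''n'' (ISet ''A'' (IAdd (IVar ''A'') (ICell ''a'' (IVar ''j''))))) s (n * (100 + 23))
      (\<lambda>s'. icells s' ''A'' 0 = int (\<Sum>j<n. a j))"
  proof (rule runs_For)
    fix k s' assume k: "k < n" and s': "icells s' ''j'' 0 = int k"
      "unchanged (For ''j'' ''n'' (ISet ''A'' (IAdd (IVar ''A'') (ICell ''a'' (IVar ''j''))))) s s'"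
      "icells s' ''A'' 0 = int (\<Sum>j<k. a j)"
    then have "icells s' ''a'' (int k) = int (a k)"
      using assms by (simp add: unchanged_def holds_instance_def)
    then show "runs (ISet ''A'' (IAdd (IVar ''A'') (ICell ''a'' (IVar ''j'')))) s' 100
        (\<lambda>s'. icells s' ''A'' 0 = int (\<Sum>j<Suc k. a j))"
      using s' by (intro runs_straight) auto
  qed (use assms n_pos in \<open>auto simp: holds_instance_def\<close>)
  then show ?thesis
    unfolding init_sizes_def
  proof (rule runs_Seq')
    fix s' assume s': "icells s' ''A'' 0 = int (\<Sum>j<n. a j)"
      "unchanged (For ''j'' ''n'' (ISet ''A'' (IAdd (IVar ''A'') (ICell ''a'' (IVar ''j''))))) s s'"
    then have "holds_instance s'"
      using assms by (simp add: holds_instance_def unchanged_def)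
    then show "runs (Seq (ISet ''W'' (IAdd (IVar ''A'') (IConst 1)))
       (Seq (ISet ''N'' (IMul (IVar ''n'') (IVar ''W'')))
          (ISet ''K'' (IMul (IConst 2) (IVar ''n''))))) s' 100 prepared"
      using s' by (intro runs_straight) (auto simp: prepared_def holds_instance_def W_def N_eq A_eq)
  qed simp
qed

lemma runs_find_next:
  assumes "prepared s" "rcells s ''be'' 0 = rcells s ''al'' 0"
  shows "runs find_next s (n * 123) (\<lambda>s'. rcells s' ''be'' 0 = next_break (rcells s ''al'' 0))"
proof -
  define t where "t = rcells s ''al'' 0"
  define Inv where "Inv = (\<lambda>k (s' :: memory). t \<le> rcells s' ''be'' 0 \<and> (rcells s' ''be'' 0 = t \<or> rcells s' ''be'' 0 \<in> breaks) \<and>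
    (\<forall>j<k. \<forall>q\<in>{l j / real (a j), u j / real (a j)}. t < q \<longrightarrow> t < rcells s' ''be'' 0 \<and> rcells s' ''be'' 0 \<le> q))"
  have "runs find_next s (n * (100 + 23)) (Inv n)"
    unfolding find_next_def
  proof (rule runs_For)
    fix k s'
    assume k: "k < n" and s': "icells s' ''j'' 0 = int k" "Inv k s'"
      and un: "unchanged (For ''j'' ''n'' (Seq
     (relax (RDiv (RCell ''c_lower'' (IVar ''j'')) (ROfInt (ICell ''a'' (IVar ''j'')))))
     (relax (RDiv (RCell ''c_upper'' (IVar ''j'')) (ROfInt (ICell ''a'' (IVar ''j''))))))) s s'"
    have [simp]: "icells s' ''a'' (int k) = int (a k)" "rcells s' ''c_lower'' (int k) = l k"
        "rcells s' ''c_upper'' (int k) = u k" "rcells s' ''al'' 0 = t"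
      using un assms k by (auto simp: relax_def unchanged_def prepared_def holds_instance_def t_def)
    define be where "be = rcells s' ''be'' 0"
    \<comment> \<open>The effect of one \<open>relax\<close> on the candidate. Each round applies it
      twice, and \<open>be1\<close> and \<open>be2\<close> are the successive candidates.\<close>
    define r where "r = (\<lambda>be q. if t < q \<and> \<not> (t < be \<and> be \<le> q) then q else be)"
    let ?p = "Seq (relax (RDiv (RCell ''c_lower'' (IVar ''j'')) (ROfInt (ICell ''a'' (IVar ''j'')))))
     (relax (RDiv (RCell ''c_upper'' (IVar ''j'')) (ROfInt (ICell ''a'' (IVar ''j'')))))"
    have res: "rcells (result ?p s') ''be'' 0 = r (r be (l k / real (a k))) (u k / real (a k))"
      using s'(1) by (auto simp: relax_def r_def be_def not_le)
    have r: "t \<le> r be q" "r be q = be \<or> r be q = q" "t < q \<Longrightarrow> t < r be q \<and> r be q \<le> q"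
        "t < be \<Longrightarrow> t < r be q \<and> r be q \<le> be" if "t \<le> be" for be q
      using that by (auto simp: r_def)
    have mem: "l k / real (a k) \<in> breaks" "u k / real (a k) \<in> breaks"
      using k by (auto simp: breaks_def)
    have be: "t \<le> be" "be = t \<or> be \<in> breaks"
      "\<And>j q. j < k \<Longrightarrow> q \<in> {l j / real (a j), u j / real (a j)} \<Longrightarrow> t < q \<Longrightarrow> t < be \<and> be \<le> q"
      using s'(2) unfolding Inv_def be_def by blast+
    define be1 where "be1 = r be (l k / real (a k))"
    have be1: "t \<le> be1" "be1 = t \<or> be1 \<in> breaks" "t < be \<Longrightarrow> t < be1 \<and> be1 \<le> be"
      "t < l k / real (a k) \<Longrightarrow> t < be1 \<and> be1 \<le> l k / real (a k)"
      using r[OF be(1), of "l k / real (a k)"] be(2) mem unfolding be1_def[symmetric] by auto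
    define be2 where "be2 = r be1 (u k / real (a k))"
    have be2: "t \<le> be2" "be2 = t \<or> be2 \<in> breaks" "t < be1 \<Longrightarrow> t < be2 \<and> be2 \<le> be1"
      "t < u k / real (a k) \<Longrightarrow> t < be2 \<and> be2 \<le> u k / real (a k)"
      using r[OF be1(1), of "u k / real (a k)"] be1(2) mem unfolding be2_def[symmetric] by auto
    have "Inv (Suc k) (result ?p s')"
      unfolding Inv_def res be1_def[symmetric] be2_def[symmetric]
    proof (intro conjI allI impI ballI)
      fix j q assume j: "j < Suc k" and q: "q \<in> {l j / real (a j), u j / real (a j)}" "t < q"
      consider "j < k" | "j = k" "q = l k / real (a k)" | "j = k" "q = u k / real (a k)"
        using j q by (auto simp: less_Suc_eq)
      then have "t < be2 \<and> be2 \<le> q"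
      proof cases
        case 1
        then show ?thesis
          using be(3)[OF 1 q] be1(3) be2(3) by force
      next
        case 2
        then show ?thesis
          using be1(4) be2(3) q by force
      next
        case 3
        then show ?thesis
          using be2(4) q by force
      qed
      then show "t < be2" "be2 \<le> q" by auto
    qed (use be2 in auto)
    then show "runs ?p s' 100 (Inv (Suc k))"
      by (rule runs_straight[rotated 2]) (simp_all add: relax_def)
  qed (use assms n_pos in \<open>auto simp: prepared_def holds_instance_def relax_def Inv_def t_def\<close>)
  then show ?thesis
  proof (rule runs_weaken)
    fix s' assume inv: "Inv n s'"
    show "rcells s' ''be'' 0 = next_break (rcells s ''al'' 0)"
      unfolding t_def[symmetric]
      by (rule next_break_eqI) (use inv in \<open>auto simp: Inv_def breaks_def\<close>)
  qed simp
qed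

lemma runs_find_probs:
  assumes "prepared s"
  shows "runs find_probs s (n * 223) (\<lambda>s'. \<forall>j<n.
    rcells s' ''pa'' (int j) = above_prob j (rcells s ''al'' 0) \<and>
    rcells s' ''pb'' (int j) = above_prob j (rcells s ''be'' 0))"
proof -
  let ?Inv = "\<lambda>k s'. \<forall>j<k. rcells s' ''pa'' (int j) = above_prob j (rcells s ''al'' 0) \<and>
    rcells s' ''pb'' (int j) = above_prob j (rcells s ''be'' 0)"
  have "runs find_probs s (n * (200 + 23)) (?Inv n)"
    unfolding find_probs_def
  proof (rule runs_For)
    fix k s'
    assume k: "k < n" and s': "icells s' ''j'' 0 = int k" "?Inv k s'"
      and un: "unchanged (For ''j'' ''n'' (Seq (set_prob ''pa'' ''al'') (set_prob ''pb'' ''be''))) s s'"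
    have [simp]: "icells s' ''a'' (int k) = int (a k)" "rcells s' ''c_lower'' (int k) = l k"
        "rcells s' ''c_upper'' (int k) = u k" "rcells s' ''al'' 0 = rcells s ''al'' 0"
        "rcells s' ''be'' 0 = rcells s ''be'' 0"
      using un assms k by (auto simp: set_prob_def unchanged_def prepared_def holds_instance_def)
    show "runs (Seq (set_prob ''pa'' ''al'') (set_prob ''pb'' ''be'')) s' 200 (?Inv (Suc k))"
      by (rule runs_straight)
         (use s' in \<open>auto simp: set_prob_def above_prob_def min_def max_def less_Suc_eq\<close>)
  qed (use assms n_pos in \<open>auto simp: prepared_def holds_instance_def set_prob_def\<close>)
  then show ?thesis
    by simp
qed

text \<open>The index ranges over all integers below \<open>N\<close>, so the zeros at negative
  indices are part of the claim.\<close>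

definition poly_is :: "(int \<Rightarrow> real) \<Rightarrow> memory \<Rightarrow> bool" where
  "poly_is f s \<longleftrightarrow> (\<forall>q < int N. rcells s ''P'' q = f q)"

lemma runs_reset_poly:
  assumes "prepared s" "\<And>q. q < 0 \<Longrightarrow> rcells s ''P'' q = 0"
  shows "runs reset_poly s (N * 223) (poly_is (\<lambda>q. of_bool (q = 0)))"
proof -
  let ?Inv = "\<lambda>k (s' :: memory). \<forall>q < int k. rcells s' ''P'' q = 0"
  have "runs (For ''q'' ''N'' (RAssign ''P'' (IVar ''q'') (ROfInt (IConst 0)))) s (N * (100 + 23)) (?Inv N)"
  proof (rule runs_For)
    fix k s' assume "icells s' ''q'' 0 = int k" "?Inv k s'"
    then show "runs (RAssign ''P'' (IVar ''q'') (ROfInt (IConst 0))) s' 100 (?Inv (Suc k))"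
      by (intro runs_straight) auto
  qed (use assms N_pos in \<open>auto simp: prepared_def\<close>)
  then show ?thesis
    unfolding reset_poly_def
  proof (rule runs_Seq')
    fix s' assume "?Inv N s'"
    then show "runs (RSet ''P'' (ROfInt (IConst 1))) s' 100 (poly_is (\<lambda>q. of_bool (q = 0)))"
      by (intro runs_straight) (auto simp: poly_is_def)
  qed (use N_pos in simp)
qed

lemma runs_mult_factor:
  assumes "prepared s" "j < n" "icells s ''j'' 0 = int j"
    and "poly_is (kcoef W \<alpha> \<beta> i j) s"
    and "rcells s ''x0'' 0 = X0 \<alpha> \<beta> i j" "rcells s ''x1'' 0 = X1 \<alpha> \<beta> i j"
      "rcells s ''x2'' 0 = X2 \<alpha> \<beta> i j" "rcells s ''x3'' 0 = X3 \<alpha> \<beta> i j"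
  shows "runs mult_factor s (N * 123) (poly_is (kcoef W \<alpha> \<beta> i (Suc j)))"
proof -
  define Inv where "Inv = (\<lambda>k (s' :: memory). \<forall>q < int N. rcells s' ''P'' q =
    (if int N - int k \<le> q then kcoef W \<alpha> \<beta> i (Suc j) q else kcoef W \<alpha> \<beta> i j q))"
  have "runs mult_factor s (N * (100 + 23)) (Inv N)"
    unfolding mult_factor_def
  proof (rule runs_For)
    show "Inv 0 (iupdate ''q'' 0 0 s)"
      using assms by (auto simp: Inv_def poly_is_def)
    let ?p = "Seq
     (ISet ''z'' (ISub (ISub (IVar ''N'') (IConst 1)) (IVar ''q'')))
     (RAssign ''P'' (IVar ''z'')
       (RAdd (RAdd (RAdd (RMul (RVar ''x0'') (RCell ''P'' (IVar ''z'')))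
         (RMul (RVar ''x1'') (RCell ''P'' (ISub (IVar ''z'') (IVar ''W'')))))
         (RMul (RVar ''x2'') (RCell ''P'' (ISub (IVar ''z'') (ICell ''a'' (IVar ''j''))))))
         (RMul (RVar ''x3'') (RCell ''P'' (ISub (ISub (IVar ''z'') (IVar ''W'')) (ICell ''a'' (IVar ''j'')))))))"
    fix k s' assume k: "k < N" and s': "icells s' ''q'' 0 = int k" "Inv k s'"
      and un: "unchanged (For ''q'' ''N'' ?p) s s'"
    have [simp]: "icells s' ''N'' 0 = int N" "icells s' ''W'' 0 = W" "icells s' ''j'' 0 = int j"
        "icells s' ''a'' (int j) = int (a j)"
        "rcells s' ''x0'' 0 = X0 \<alpha> \<beta> i j" "rcells s' ''x1'' 0 = X1 \<alpha> \<beta> i j"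
        "rcells s' ''x2'' 0 = X2 \<alpha> \<beta> i j" "rcells s' ''x3'' 0 = X3 \<alpha> \<beta> i j"
      using un assms by (auto simp: unchanged_def prepared_def holds_instance_def)
    define z where "z = int N - 1 - int k"
    have W: "0 < W" by (simp add: W_def)
    \<comment> \<open>Pass \<open>k\<close> writes index \<open>z\<close>; all four reads are at
      indices at most \<open>z\<close>, which still hold the old coefficients.\<close>
    have old: "rcells s' ''P'' q = kcoef W \<alpha> \<beta> i j q" if "q \<le> z" for q
      using s'(2) that unfolding Inv_def z_def by auto
    have olds: "rcells s' ''P'' z = kcoef W \<alpha> \<beta> i j z" "rcells s' ''P'' (z - W) = kcoef W \<alpha> \<beta> i j (z - W)"
      "rcells s' ''P'' (z - int (a j)) = kcoef W \<alpha> \<beta> i j (z - int (a j))"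
      "rcells s' ''P'' (z - W - int (a j)) = kcoef W \<alpha> \<beta> i j (z - W - int (a j))"
      using W by (auto intro!: old)
    have res: "rcells (result ?p s') ''P'' = (rcells s' ''P'')(z := kcoef W \<alpha> \<beta> i (Suc j) z)"
      using s'(1) olds by (simp add: z_def[symmetric])
    have "Inv (Suc k) (result ?p s')"
      unfolding Inv_def res using s'(2) unfolding Inv_def by (auto simp: z_def)
    then show "runs ?p s' 100 (Inv (Suc k))"
      by (rule runs_straight[rotated 2]) simp_all
  qed (use assms N_pos in \<open>auto simp: prepared_def Inv_def\<close>)
  then show ?thesis
  proof (rule runs_weaken)
    fix s' assume inv: "Inv N s'"
    \<comment> \<open>Negative cells are never overwritten; old and new coefficients agree there
      because both are 0.\<close>
    have "kcoef W \<alpha> \<beta> i j' q = 0" if "q < 0" for q j'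
      using that by (intro kcoef_negative) (auto simp: W_def)
    then show "poly_is (kcoef W \<alpha> \<beta> i (Suc j)) s'"
      using inv unfolding Inv_def poly_is_def by (metis diff_self not_le)
  qed simp
qed

definition probs_are :: "real \<Rightarrow> real \<Rightarrow> memory \<Rightarrow> bool" where
  "probs_are \<alpha> \<beta> s \<longleftrightarrow> (\<forall>j<n.
    rcells s ''pa'' (int j) = above_prob j \<alpha> \<and> rcells s ''pb'' (int j) = above_prob j \<beta>)"

lemma runs_build_poly:
  assumes "prepared s" "i < n" "icells s ''i'' 0 = int i" "probs_are \<alpha> \<beta> s"
    and "poly_is (\<lambda>q. of_bool (q = 0)) s"
  shows "runs build_poly s (n * (N * 246)) (poly_is (kcoef W \<alpha> \<beta> i n))"
proof -
  have "runs build_poly s (n * (N * 223 + 23)) (poly_is (kcoef W \<alpha> \<beta> i n))"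
    unfolding build_poly_def
  proof (rule runs_For)
    show "poly_is (kcoef W \<alpha> \<beta> i 0) (iupdate ''j'' 0 0 s)"
      using assms by (simp add: poly_is_def)
    fix j s' assume j: "j < n" and s': "icells s' ''j'' 0 = int j" "poly_is (kcoef W \<alpha> \<beta> i j) s'"
      and un: "unchanged (For ''j'' ''n'' (Seq set_factor mult_factor)) s s'"
    have prep: "prepared s'"
      by (rule prepared_unchanged[OF assms(1) un]) (auto simp: fixed_inames_def fixed_rnames_def)
    have [simp]: "icells s' ''i'' 0 = int i" "rcells s' ''pa'' (int j) = above_prob j \<alpha>"
        "rcells s' ''pb'' (int j) = above_prob j \<beta>"
      using un assms j by (auto simp: unchanged_def probs_are_def)
    have "runs set_factor s' 100 (\<lambda>s''. rcells s'' ''x0'' 0 = X0 \<alpha> \<beta> i j \<and> rcells s'' ''x1'' 0 = X1 \<alpha> \<beta> i j \<and>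
        rcells s'' ''x2'' 0 = X2 \<alpha> \<beta> i j \<and> rcells s'' ''x3'' 0 = X3 \<alpha> \<beta> i j)"
      using s' by (intro runs_straight) (auto simp: set_factor_def X0_def X1_def X2_def X3_def)
    then show "runs (Seq set_factor mult_factor) s' (N * 223) (poly_is (kcoef W \<alpha> \<beta> i (Suc j)))"
    proof (rule runs_Seq')
      fix s'' assume x: "rcells s'' ''x0'' 0 = X0 \<alpha> \<beta> i j \<and> rcells s'' ''x1'' 0 = X1 \<alpha> \<beta> i j \<and>
        rcells s'' ''x2'' 0 = X2 \<alpha> \<beta> i j \<and> rcells s'' ''x3'' 0 = X3 \<alpha> \<beta> i j"
        and un: "unchanged set_factor s' s''"
      have "prepared s''"
        by (rule prepared_unchanged[OF prep un]) (auto simp: fixed_inames_def fixed_rnames_def)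
      then show "runs mult_factor s'' (N * 123) (poly_is (kcoef W \<alpha> \<beta> i (Suc j)))"
        by (rule runs_mult_factor[OF _ j]) (use x un s' in \<open>auto simp: unchanged_def poly_is_def\<close>)
    qed (use N_pos in simp)
  qed (use assms n_pos in \<open>auto simp: prepared_def holds_instance_def poly_is_def\<close>)
  then show ?thesis
    by (rule runs_weaken) (use N_pos in simp_all)
qed

text \<open>\<open>H\<close> will hold the jumps; their partial sums, the slopes up to the price,
  are formed only during the search.\<close>

definition slopes_are :: "(nat \<Rightarrow> real) \<Rightarrow> memory \<Rightarrow> bool" where
  "slopes_are h s \<longleftrightarrow> (\<forall>v<A. rcells s ''H'' (int v) = h v)"

lemma runs_accumulate:
  assumes "prepared s" "poly_is f s" "rcells s ''w'' 0 = w" "slopes_are h s"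
  shows "runs accumulate s (n * (A * 146))
    (slopes_are (\<lambda>v. h v + w * (\<Sum>m<n. f (int m * W + int v) / (real m + 1))))"
proof -
  let ?g = "\<lambda>m v. h v + w * (\<Sum>m<m. f (int m * W + int v) / (real m + 1))"
  let ?p = "RAssign ''H'' (IVar ''v'') (RAdd (RCell ''H'' (IVar ''v''))
       (RMul (RVar ''w'')
         (RDiv (RCell ''P'' (IAdd (IMul (IVar ''m'') (IVar ''W'')) (IVar ''v'')))
               (RAdd (ROfInt (IVar ''m'')) (ROfInt (IConst 1))))))"
  have "runs accumulate s (n * (A * 123 + 23)) (slopes_are (?g n))"
    unfolding accumulate_def
  proof (rule runs_For)
    show "slopes_are (?g 0) (iupdate ''m'' 0 0 s)"
      using assms by (simp add: slopes_are_def)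
    fix m s' assume m: "m < n" and s': "icells s' ''m'' 0 = int m" "slopes_are (?g m) s'"
      and un: "unchanged (For ''m'' ''n'' (For ''v'' ''A'' ?p)) s s'"
    have prep: "prepared s'"
      by (rule prepared_unchanged[OF assms(1) un]) (auto simp: fixed_inames_def fixed_rnames_def)
    \<comment> \<open>Inside row \<open>m\<close>, the first \<open>k\<close> entries of
      \<open>H\<close> already include this row.\<close>
    let ?h = "\<lambda>k v. if v < k then ?g (Suc m) v else ?g m v"
    have "runs (For ''v'' ''A'' ?p) s' (A * (100 + 23)) (slopes_are (?h A))"
    proof (rule runs_For)
      show "slopes_are (?h 0) (iupdate ''v'' 0 0 s')"
        using s' by (simp add: slopes_are_def)
      fix k s'' assume k: "k < A" and s'': "icells s'' ''v'' 0 = int k" "slopes_are (?h k) s''"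
        and un': "unchanged (For ''v'' ''A'' ?p) s' s''"
      have "(int m + 1) * W \<le> int n * W"
        using m by (intro mult_right_mono) (auto simp: W_def)
      then have "int m * W + int k < int N"
        using k by (simp add: N_eq W_def algebra_simps)
      then have [simp]: "rcells s'' ''P'' (int m * W + int k) = f (int m * W + int k)"
        using un un' assms by (simp add: unchanged_def poly_is_def)
      have [simp]: "icells s'' ''W'' 0 = W" "icells s'' ''m'' 0 = int m" "rcells s'' ''w'' 0 = w"
        using un un' assms s' by (auto simp: unchanged_def prepared_def)
      show "runs ?p s'' 100 (slopes_are (?h (Suc k)))"
        by (rule runs_straight) (use k s'' in \<open>auto simp: slopes_are_def less_Suc_eq distrib_left\<close>)
    qed (use prep A_pos in \<open>auto simp: prepared_def slopes_are_def\<close>)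
    then show "runs (For ''v'' ''A'' ?p) s' (A * 123) (slopes_are (?g (Suc m)))"
      by (rule runs_weaken) (auto simp: slopes_are_def)
  qed (use assms n_pos in \<open>auto simp: prepared_def holds_instance_def slopes_are_def\<close>)
  then show ?thesis
    by (rule runs_weaken) (use A_pos in simp_all)
qed

text \<open>Carried as an invariant because \<open>reset_poly\<close> clears only the indices below
  \<open>N\<close> from 0 on; the negative cells must still have their initial zeros.\<close>

abbreviation negative_clear :: "memory \<Rightarrow> bool" where
  "negative_clear s \<equiv> (\<forall>q<0. rcells s ''P'' q = 0)"

lemma kcoef_clear:
  assumes "poly_is (kcoef W \<alpha> \<beta> i j) s" shows "negative_clear s"
  using assms N_pos kcoef_negative[of W] by (auto simp: poly_is_def W_def)

definition item_share :: "nat \<Rightarrow> nat \<Rightarrow> nat \<Rightarrow> real" where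
  "item_share k i v = weight k i *
     (\<Sum>m<n. kcoef W (brk k) (brk (Suc k)) i n (int m * W + int v) / (real m + 1))"

lemma runs_all_items:
  assumes "prepared s" "probs_are (brk k) (brk (Suc k)) s" "negative_clear s" "slopes_are h s"
  shows "runs all_items s (n * (n * (N * 738)))
    (\<lambda>s'. negative_clear s' \<and> slopes_are (\<lambda>v. h v + (\<Sum>i<n. item_share k i v)) s')"
proof -
  let ?Inv = "\<lambda>j s'. negative_clear s' \<and> slopes_are (\<lambda>v. h v + (\<Sum>i<j. item_share k i v)) s'"
  let ?p = "Seq reset_poly (Seq build_poly (Seq set_weight accumulate))"
  have "runs all_items s (n * (n * (N * 715) + 23)) (?Inv n)"
    unfolding all_items_def
  proof (rule runs_For)
    fix i s0 assume i: "i < n" and s0: "icells s0 ''i'' 0 = int i" "?Inv i s0"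
      and un0: "unchanged (For ''i'' ''n'' ?p) s s0"
    have prep0: "prepared s0"
      by (rule prepared_unchanged[OF assms(1) un0]) (auto simp: fixed_inames_def fixed_rnames_def)
    have probs0: "probs_are (brk k) (brk (Suc k)) s0"
      using un0 assms(2) by (simp add: unchanged_def probs_are_def)
    have "runs reset_poly s0 (N * 223) (poly_is (\<lambda>q. of_bool (q = 0)))"
      using prep0 s0 by (intro runs_reset_poly) auto
    then have "runs ?p s0 (N * 223 + (n * (N * 246) + (100 + n * (A * 146)))) (?Inv (Suc i))"
    proof (rule runs_Seq')
      fix s1 assume P1: "poly_is (\<lambda>q. of_bool (q = 0)) s1" and un1: "unchanged reset_poly s0 s1"
      have prep1: "prepared s1"
        by (rule prepared_unchanged[OF prep0 un1]) (auto simp: fixed_inames_def fixed_rnames_def)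
      have "runs build_poly s1 (n * (N * 246)) (poly_is (kcoef W (brk k) (brk (Suc k)) i n))"
        using un1 s0 probs0 by (intro runs_build_poly prep1 i P1) (auto simp: unchanged_def probs_are_def)
      then show "runs (Seq build_poly (Seq set_weight accumulate)) s1
          (n * (N * 246) + (100 + n * (A * 146))) (?Inv (Suc i))"
      proof (rule runs_Seq')
        fix s2 assume P2: "poly_is (kcoef W (brk k) (brk (Suc k)) i n) s2" and un2: "unchanged build_poly s1 s2"
        have prep2: "prepared s2"
          by (rule prepared_unchanged[OF prep1 un2]) (auto simp: fixed_inames_def fixed_rnames_def)
        have [simp]: "icells s2 ''i'' 0 = int i" "rcells s2 ''pa'' (int i) = above_prob i (brk k)"
          "rcells s2 ''pb'' (int i) = above_prob i (brk (Suc k))"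
          "icells s2 ''a'' (int i) = int (a i)" "icells s2 ''d'' (int i) = leader_value I i"
          using un1 un2 s0 probs0 prep2 i by (auto simp: unchanged_def probs_are_def prepared_def holds_instance_def)
        have "runs set_weight s2 100 (\<lambda>s'. rcells s' ''w'' 0 = weight k i)"
          by (rule runs_straight) (auto simp: set_weight_def weight_def simp del: brk_simps(2))
        then show "runs (Seq set_weight accumulate) s2 (100 + n * (A * 146)) (?Inv (Suc i))"
        proof (rule runs_Seq')
          fix s3 assume w: "rcells s3 ''w'' 0 = weight k i" and un3: "unchanged set_weight s2 s3"
          have prep3: "prepared s3"
            by (rule prepared_unchanged[OF prep2 un3]) (auto simp: fixed_inames_def fixed_rnames_def)
          have P3: "poly_is (kcoef W (brk k) (brk (Suc k)) i n) s3"
            using P2 un3 by (simp add: poly_is_def unchanged_def)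
          have H3: "slopes_are (\<lambda>v. h v + (\<Sum>i<i. item_share k i v)) s3"
            using s0 un1 un2 un3 by (simp add: slopes_are_def unchanged_def)
          show "runs accumulate s3 (n * (A * 146)) (?Inv (Suc i))"
            by (rule runs_weaken[OF runs_unchanged[OF runs_accumulate[OF prep3 P3 w H3]]])
               (use kcoef_clear[OF P3] in \<open>auto simp: slopes_are_def unchanged_def item_share_def\<close>)
        qed simp
      qed simp
    qed simp
    \<comment> \<open>223 + 246 + 100 + 146 = 715, by \<open>N \<le> n * N\<close>,
      \<open>1 \<le> n * N\<close> and \<open>A \<le> N\<close>.\<close>
    moreover have "N * 223 + (n * (N * 246) + (100 + n * (A * 146))) \<le> n * (N * 715)"
    proof -
      have "N \<le> n * N" "1 \<le> n * N" "n * A \<le> n * N"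
        using n_pos N_pos A_le_N by (auto simp: Suc_le_eq)
      moreover have "n * (N * c) = c * (n * N)" "n * (A * c) = c * (n * A)" for c
        by simp_all
      ultimately show ?thesis
        by linarith
    qed
    ultimately show "runs ?p s0 (n * (N * 715)) (?Inv (Suc i))"
      by (rule runs_weaken)
  qed (use assms n_pos in \<open>auto simp: prepared_def holds_instance_def slopes_are_def\<close>)
  then show ?thesis
  proof (rule runs_weaken)
    have "1 \<le> n * N"
      using n_pos N_pos by (simp add: Suc_le_eq)
    then show "n * (n * (N * 715) + 23) \<le> n * (n * (N * 738))"
      by (intro mult_le_mono2) simp
  qed
qed

lemma runs_all_intervals:
  assumes "prepared s" "rcells s ''al'' 0 = 0" "negative_clear s" "slopes_are (\<lambda>_. 0) s"
  shows "runs all_intervals s (2 * n * (n * (n * (N * 1400)))) (slopes_are jump)"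
proof -
  let ?Inv = "\<lambda>k s'. rcells s' ''al'' 0 = brk k \<and> negative_clear s' \<and>
    slopes_are (\<lambda>v. \<Sum>k<k. \<Sum>i<n. item_share k i v) s'"
  let ?p = "Seq (RSet ''be'' (RVar ''al'')) (Seq find_next (Seq find_probs (Seq all_items (RSet ''al'' (RVar ''be'')))))"
  have "runs all_intervals s (2 * n * (n * (n * (N * 1300)) + 23)) (?Inv (2 * n))"
    unfolding all_intervals_def
  proof (rule runs_For)
    fix k s0 assume s0: "?Inv k s0" and un0: "unchanged (For ''k'' ''K'' ?p) s s0"
    have prep0: "prepared s0"
      by (rule prepared_unchanged[OF assms(1) un0]) (auto simp: fixed_inames_def fixed_rnames_def)
    have "runs (RSet ''be'' (RVar ''al'')) s0 100 (\<lambda>s'. rcells s' ''be'' 0 = brk k)"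
      using s0 by (intro runs_straight) auto
    then have "runs ?p s0 (100 + (n * 123 + (n * 223 + (n * (n * (N * 738)) + 100)))) (?Inv (Suc k))"
    proof (rule runs_Seq')
      fix s1 assume be1: "rcells s1 ''be'' 0 = brk k" and un1: "unchanged (RSet ''be'' (RVar ''al'')) s0 s1"
      have prep1: "prepared s1"
        by (rule prepared_unchanged[OF prep0 un1]) (auto simp: fixed_inames_def fixed_rnames_def)
      have al1: "rcells s1 ''al'' 0 = brk k"
        using un1 s0 by (simp add: unchanged_def)
      have "runs find_next s1 (n * 123) (\<lambda>s'. rcells s' ''be'' 0 = next_break (rcells s1 ''al'' 0))"
        using be1 al1 by (intro runs_find_next prep1) simp
      then show "runs (Seq find_next (Seq find_probs (Seq all_items (RSet ''al'' (RVar ''be''))))) s1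
          (n * 123 + (n * 223 + (n * (n * (N * 738)) + 100))) (?Inv (Suc k))"
      proof (rule runs_Seq')
        fix s2 assume "rcells s2 ''be'' 0 = next_break (rcells s1 ''al'' 0)" and un2: "unchanged find_next s1 s2"
        then have be2: "rcells s2 ''be'' 0 = brk (Suc k)" and al2: "rcells s2 ''al'' 0 = brk k"
          using al1 by (simp_all add: unchanged_def)
        have prep2: "prepared s2"
          by (rule prepared_unchanged[OF prep1 un2]) (auto simp: fixed_inames_def fixed_rnames_def)
        have "runs find_probs s2 (n * 223) (probs_are (brk k) (brk (Suc k)))"
          by (rule runs_weaken[OF runs_find_probs[OF prep2]]) (use be2 al2 in \<open>auto simp: probs_are_def\<close>)
        then show "runs (Seq find_probs (Seq all_items (RSet ''al'' (RVar ''be'')))) s2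
            (n * 223 + (n * (n * (N * 738)) + 100)) (?Inv (Suc k))"
        proof (rule runs_Seq')
          fix s3 assume pr3: "probs_are (brk k) (brk (Suc k)) s3" and un3: "unchanged find_probs s2 s3"
          have prep3: "prepared s3"
            by (rule prepared_unchanged[OF prep2 un3]) (auto simp: fixed_inames_def fixed_rnames_def)
          have be3: "rcells s3 ''be'' 0 = brk (Suc k)"
            using be2 un3 by (simp add: unchanged_def)
          have "negative_clear s3" "slopes_are (\<lambda>v. \<Sum>k<k. \<Sum>i<n. item_share k i v) s3"
            using s0 un1 un2 un3 by (simp_all add: unchanged_def slopes_are_def)
          note runs_all_items[OF prep3 pr3 this]
          then show "runs (Seq all_items (RSet ''al'' (RVar ''be''))) s3 (n * (n * (N * 738)) + 100) (?Inv (Suc k))"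
          proof (rule runs_Seq')
            fix s4 assume 4: "negative_clear s4 \<and>
                slopes_are (\<lambda>v. (\<Sum>k<k. \<Sum>i<n. item_share k i v) + (\<Sum>i<n. item_share k i v)) s4"
              and un4: "unchanged all_items s3 s4"
            have "rcells s4 ''be'' 0 = brk (Suc k)"
              using be3 un4 by (simp add: unchanged_def)
            with 4 show "runs (RSet ''al'' (RVar ''be'')) s4 100 (?Inv (Suc k))"
              by (intro runs_straight) (auto simp: slopes_are_def)
          qed simp
        qed simp
      qed simp
    qed simp
    \<comment> \<open>The coefficients add up to 1284, which 1300 covers; lower powers of
      \<open>n\<close> are raised to \<open>n * (n * N)\<close>.\<close>
    moreover have "100 + (n * 123 + (n * 223 + (n * (n * (N * 738)) + 100))) \<le> n * (n * (N * 1300))"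
    proof -
      have "1 \<le> n * N"
        using n_pos N_pos by (simp add: Suc_le_eq)
      then have "n * 1 \<le> n * (n * N)"
        by (rule mult_le_mono2)
      moreover have "n * (n * (N * c)) = c * (n * (n * N))" for c
        by simp
      ultimately show ?thesis
        using n_pos by linarith
    qed
    ultimately show "runs ?p s0 (n * (n * (N * 1300))) (?Inv (Suc k))"
      by (rule runs_weaken)
  qed (use assms n_pos in \<open>auto simp: prepared_def slopes_are_def\<close>)
  moreover have "2 * n * (n * (n * (N * 1300)) + 23) \<le> 2 * n * (n * (n * (N * 1400)))"
  proof (rule mult_le_mono2)
    have "1 \<le> n * (n * N)"
      using n_pos N_pos by (simp add: Suc_le_eq)
    moreover have "n * (n * (N * c)) = c * (n * (n * N))" for c
      by simp
    ultimately show "n * (n * (N * 1300)) + 23 \<le> n * (n * (N * 1400))"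
      by linarith
  qed
  ultimately show ?thesis
    by (rule runs_weaken) (auto simp: slopes_are_def jump_def item_share_def)
qed

section \<open>Maximizing the piecewise linear objective\<close>

definition pos :: "nat \<Rightarrow> real" where
  "pos v = min (b_upper I) (max (b_lower I) (real v))"

lemma pos_range: "b_lower I \<le> pos v" "pos v \<le> b_upper I" "pos v \<le> pos (Suc v)"
  using b_range by (auto simp: pos_def)

text \<open>Between \<open>v\<close> and \<open>v + 1\<close> only the ramp of slot \<open>v\<close>
  moves; all others are already 0 or 1.\<close>

lemma objective_linear:
  assumes "v < A" "real v \<le> x" "x \<le> y" "y \<le> real v + 1"
  shows "objective y - objective x = slope v * (y - x)"
proof -
  have "objective y - objective x = (\<Sum>w<A. slope w * (clamp01 (y - real w) - clamp01 (x - real w)))"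
    by (simp add: objective_def sum_subtractf right_diff_distrib)
  also have "\<dots> = (\<Sum>w\<in>{v}. slope w * (clamp01 (y - real w) - clamp01 (x - real w)))"
  proof (rule sum.mono_neutral_right)
    show "\<forall>w\<in>{..<A} - {v}. slope w * (clamp01 (y - real w) - clamp01 (x - real w)) = 0"
    proof
      fix w assume "w \<in> {..<A} - {v}"
      then have "real w + 1 \<le> real v \<or> real v + 1 \<le> real w"
        by auto
      then have "clamp01 (y - real w) = clamp01 (x - real w)"
        using assms by (auto simp: clamp01_def)
      then show "slope w * (clamp01 (y - real w) - clamp01 (x - real w)) = 0"
        by simp
    qed
  qed (use assms in auto)
  also have "\<dots> = slope v * (y - x)"
    using assms by (auto simp: clamp01_def)
  finally show ?thesis .
qed

text \<open>The points \<open>pos v\<close>, integers clamped to the admissible range, run from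
  \<open>b_lower\<close> to \<open>b_upper\<close>. A piece between neighbours is either a single
  point or lies within one unit slot.\<close>

lemma objective_on_piece:
  assumes "v < A" "pos v \<le> x" "x \<le> pos (Suc v)"
  shows "objective x - objective (pos v) = slope v * (x - pos v)"
proof (cases "pos v = pos (Suc v)")
  case True
  then show ?thesis using assms by simp
next
  case False
  then have "real v \<le> pos v" "pos (Suc v) \<le> real v + 1"
    using b_range by (auto simp: pos_def min_def max_def split: if_splits)
  then show ?thesis
    using assms by (intro objective_linear) auto
qed

definition search_inv :: "nat \<Rightarrow> memory \<Rightarrow> bool" where
  "search_inv v s \<longleftrightarrow>
     rcells s ''r'' 0 = (\<Sum>s<v. jump s) \<and>
     rcells s ''base'' 0 = (\<Sum>w<v. slope w * clamp01 (b_lower I - real w)) \<and>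
     rcells s ''lo'' 0 = pos v \<and>
     rcells s ''cur'' 0 = objective (pos v) - objective (b_lower I) \<and>
     rcells s ''b'' 0 \<in> {b_lower I..b_upper I} \<and>
     rcells s ''best'' 0 = objective (rcells s ''b'' 0) - objective (b_lower I) \<and>
     (\<forall>x\<in>{b_lower I..pos v}. objective x - objective (b_lower I) \<le> rcells s ''best'' 0)"

lemma search_inv_step:
  assumes v: "v < A" "icells s ''v'' 0 = int v" and inv: "search_inv v s"
    and prep: "prepared s" and H: "slopes_are jump s"
  shows "search_inv (Suc v) (result search_step s)"
proof -
  define cur where "cur = objective (pos (Suc v)) - objective (b_lower I)"
  define b best where "b = rcells s ''b'' 0" and "best = rcells s ''best'' 0"
  have bl: "rcells s ''b_lower'' 0 = b_lower I" "rcells s ''b_upper'' 0 = b_upper I"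
    "rcells s ''delta'' 0 = unit_price I" "rcells s ''H'' (int v) = jump v"
    using prep H v by (auto simp: prepared_def holds_instance_def slopes_are_def)
  have inv': "rcells s ''r'' 0 = (\<Sum>s<v. jump s)"
     "rcells s ''base'' 0 = (\<Sum>w<v. slope w * clamp01 (b_lower I - real w))"
     "rcells s ''lo'' 0 = pos v" "rcells s ''cur'' 0 = objective (pos v) - objective (b_lower I)"
     "b \<in> {b_lower I..b_upper I}" "best = objective b - objective (b_lower I)"
     "\<And>x. x \<in> {b_lower I..pos v} \<Longrightarrow> objective x - objective (b_lower I) \<le> best"
    using inv unfolding search_inv_def b_def best_def by auto
  have cur: "objective (pos v) - objective (b_lower I) + slope v * (pos (Suc v) - pos v) = cur"
    using objective_on_piece[OF v(1), of "pos (Suc v)"] pos_range by (simp add: cur_def)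
  define R S B where "R = (\<Sum>s<Suc v. jump s)" and "S = slope v"
    and "B = (\<Sum>w<Suc v. slope w * clamp01 (b_lower I - real w))"
  \<comment> \<open>\<open>y\<close>, \<open>y'\<close>, \<open>c\<close> are the successive
    contents of \<open>x\<close>, and \<open>h\<close>, \<open>h'\<close>, \<open>p\<close> those of
    \<open>hi\<close>. With them every instruction becomes a single update \<open>s1\<close>, ...,
    \<open>s11\<close>, free of case splits.\<close>
  define y y' c where "y = b_lower I - real v" and "y' = (if y \<le> 0 then 0 else y)" and "c = clamp01 y"
  define h h' p where "h = real v + 1" and "h' = (if h \<le> b_lower I then b_lower I else h)" and "p = pos (Suc v)"
  have c: "c = (if 1 \<le> y' then 1 else y')"
    by (auto simp: c_def y'_def clamp01_def)
  have p: "p = (if b_upper I \<le> h' then b_upper I else h')"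
    by (auto simp: p_def h'_def h_def pos_def)
  define s1 where "s1 = rupdate ''r'' 0 R s"
  define s2 where "s2 = rupdate ''sl'' 0 S s1"
  define s3 where "s3 = rupdate ''x'' 0 y s2"
  define s4 where "s4 = rupdate ''x'' 0 y' s3"
  define s5 where "s5 = rupdate ''x'' 0 c s4"
  define s6 where "s6 = rupdate ''base'' 0 B s5"
  define s7 where "s7 = rupdate ''hi'' 0 h s6"
  define s8 where "s8 = rupdate ''hi'' 0 h' s7"
  define s9 where "s9 = rupdate ''hi'' 0 p s8"
  define s10 where "s10 = rupdate ''cur'' 0 cur s9"
  define s11 where "s11 = rupdate ''lo'' 0 p s10"
  note states = s11_def s10_def s9_def s8_def s7_def s6_def s5_def s4_def s3_def s2_def s1_def
  have "result (RSet ''r'' (RAdd (RVar ''r'') (RCell ''H'' (IVar ''v'')))) s = s1"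
    by (simp add: s1_def R_def bl v inv')
  moreover have "result (RSet ''sl'' (RSub (RVar ''r'') (RVar ''delta''))) s1 = s2"
    by (simp add: states bl S_def R_def slope_def)
  moreover have "result (RSet ''x'' (RSub (RVar ''b_lower'') (ROfInt (IVar ''v'')))) s2 = s3"
    by (simp add: states bl v y_def)
  moreover have "result (Cond (RLe (RVar ''x'') (ROfInt (IConst 0))) (RSet ''x'' (ROfInt (IConst 0))) Skip) s3 = s4"
    unfolding result_Cond_Skip s4_def y'_def by (simp add: s3_def)
  moreover have "result (Cond (RLe (ROfInt (IConst 1)) (RVar ''x'')) (RSet ''x'' (ROfInt (IConst 1))) Skip) s4 = s5"
    unfolding result_Cond_Skip s5_def c by (simp add: s4_def)
  moreover have "result (RSet ''base'' (RAdd (RVar ''base'') (RMul (RVar ''sl'') (RVar ''x'')))) s5 = s6"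
    by (simp add: states inv' B_def S_def c_def y_def)
  moreover have "result (RSet ''hi'' (ROfInt (IAdd (IVar ''v'') (IConst 1)))) s6 = s7"
    by (simp add: states v h_def)
  moreover have "result (Cond (RLe (RVar ''hi'') (RVar ''b_lower'')) (RSet ''hi'' (RVar ''b_lower'')) Skip) s7 = s8"
    unfolding result_Cond_Skip s8_def h'_def by (simp add: states bl)
  moreover have "result (Cond (RLe (RVar ''b_upper'') (RVar ''hi'')) (RSet ''hi'' (RVar ''b_upper'')) Skip) s8 = s9"
    unfolding result_Cond_Skip s9_def p by (simp add: states bl)
  moreover have "result (RSet ''cur'' (RAdd (RVar ''cur'') (RMul (RVar ''sl'') (RSub (RVar ''hi'') (RVar ''lo''))))) s9 = s10"
    using cur by (simp add: states inv' S_def p_def)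
  moreover have "result (RSet ''lo'' (RVar ''hi'')) s10 = s11"
    by (simp add: states)
  ultimately have step: "result search_step s = result (Cond (RLe (RVar ''cur'') (RVar ''best'')) Skip
      (Seq (RSet ''best'' (RVar ''cur'')) (RSet ''b'' (RVar ''hi'')))) s11"
    unfolding search_step_def by (simp only: result.simps(4))
  have s11: "rcells s11 ''r'' 0 = R" "rcells s11 ''base'' 0 = B" "rcells s11 ''lo'' 0 = p"
    "rcells s11 ''cur'' 0 = cur" "rcells s11 ''hi'' 0 = p" "rcells s11 ''b'' 0 = b" "rcells s11 ''best'' 0 = best"
    by (simp_all add: states b_def best_def)
  have res: "rcells (result search_step s) ''r'' 0 = R" "rcells (result search_step s) ''base'' 0 = B"
    "rcells (result search_step s) ''lo'' 0 = p" "rcells (result search_step s) ''cur'' 0 = cur"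
    "rcells (result search_step s) ''b'' 0 = (if cur \<le> best then b else p)"
    "rcells (result search_step s) ''best'' 0 = (if cur \<le> best then best else cur)"
    unfolding step by (cases "cur \<le> best"; simp add: s11)+
  \<comment> \<open>On the new piece the objective is linear, so its maximum is at an end:
    \<open>best\<close> covers \<open>pos v\<close>, and \<open>cur\<close> is the value at
    \<open>pos (Suc v)\<close>.\<close>
  have opt: "objective x - objective (b_lower I) \<le> max best cur" if x: "x \<in> {b_lower I..pos (Suc v)}" for x
  proof (cases "x \<le> pos v")
    case True
    then show ?thesis
      using inv'(7)[of x] x by auto
  next
    case False
    then have "objective x - objective (pos v) = slope v * (x - pos v)"
      using x v by (intro objective_on_piece) auto
    moreover have "slope v * (x - pos v) \<le> max 0 (slope v * (pos (Suc v) - pos v))"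
    proof (cases "0 \<le> slope v")
      case True
      then show ?thesis
        using x by (simp add: mult_left_mono le_max_iff_disj)
    next
      case neg: False
      then have "slope v * (x - pos v) \<le> 0"
        using False by (intro mult_nonpos_nonneg) auto
      then show ?thesis by simp
    qed
    moreover have "objective (pos v) - objective (b_lower I) \<le> best"
      using inv'(7) pos_range by simp
    ultimately show ?thesis
      using cur by (auto simp: max_def split: if_splits)
  qed
  have opt': "objective x - objective (b_lower I) \<le> (if cur \<le> best then best else cur)"
    if "x \<in> {b_lower I..pos (Suc v)}" for x
    using opt[OF that] by auto
  show ?thesis
    unfolding search_inv_def res unfolding R_def B_def p_def
    using inv'(5,6) pos_range[of "Suc v"] opt' by (simp add: cur_def)
qed

lemma runs_search:
  assumes "prepared s" "slopes_are jump s"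
    and "rcells s ''r'' 0 = 0" "rcells s ''base'' 0 = 0" "rcells s ''cur'' 0 = 0" "rcells s ''best'' 0 = 0"
  shows "runs search s (A * 323 + 200) (\<lambda>s'. rcells s' ''b'' 0 \<in> {b_lower I..b_upper I} \<and>
    rcells s' ''value'' 0 = objective (rcells s' ''b'' 0) \<and>
    (\<forall>x\<in>{b_lower I..b_upper I}. objective x \<le> objective (rcells s' ''b'' 0)))"
    (is "runs search s ?T ?Q")
proof -
  have pos0: "pos 0 = b_lower I" and posA: "pos A = b_upper I"
    using b_range by (auto simp: pos_def)
  have bl: "rcells s ''b_lower'' 0 = b_lower I"
    using assms by (simp add: prepared_def holds_instance_def)
  have "runs (RSet ''lo'' (RVar ''b_lower'')) s 50 (\<lambda>s'. rcells s' ''lo'' 0 = b_lower I)"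
    using bl by (intro runs_straight) auto
  then show ?thesis
    unfolding search_def
  proof (rule runs_Seq')
    fix s1 assume lo1: "rcells s1 ''lo'' 0 = b_lower I" and un1: "unchanged (RSet ''lo'' (RVar ''b_lower'')) s s1"
    have prep1: "prepared s1"
      by (rule prepared_unchanged[OF assms(1) un1]) (auto simp: fixed_inames_def fixed_rnames_def)
    have "runs (RSet ''b'' (RVar ''b_lower'')) s1 50 (\<lambda>s'. rcells s' ''b'' 0 = b_lower I)"
      using un1 bl by (intro runs_straight) (auto simp: unchanged_def)
    then show "runs (Seq (RSet ''b'' (RVar ''b_lower'')) (Seq (For ''v'' ''A'' search_step)
          (RSet ''value'' (RAdd (RVar ''base'') (RVar ''best''))))) s1 (50 + (A * 323 + 100)) ?Q"
    proof (rule runs_Seq')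
      fix s2 assume b2: "rcells s2 ''b'' 0 = b_lower I" and un2: "unchanged (RSet ''b'' (RVar ''b_lower'')) s1 s2"
      have prep2: "prepared s2"
        by (rule prepared_unchanged[OF prep1 un2]) (auto simp: fixed_inames_def fixed_rnames_def)
      have H2: "slopes_are jump s2"
        using assms un1 un2 by (simp add: slopes_are_def unchanged_def)
      have "runs (For ''v'' ''A'' search_step) s2 (A * (300 + 23)) (search_inv A)"
      proof (rule runs_For)
        show "search_inv 0 (iupdate ''v'' 0 0 s2)"
          using b2 lo1 un1 un2 assms b_range pos0 by (auto simp: search_inv_def unchanged_def)
        fix v s' assume v: "v < A" "icells s' ''v'' 0 = int v" and un: "unchanged (For ''v'' ''A'' search_step) s2 s'"
          and inv: "search_inv v s'"
        have prep: "prepared s'"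
          by (rule prepared_unchanged[OF prep2 un])
             (auto simp: fixed_inames_def fixed_rnames_def search_step_def)
        have "slopes_are jump s'"
          using H2 un by (simp add: slopes_are_def unchanged_def search_step_def)
        then have "search_inv (Suc v) (result search_step s')"
          by (rule search_inv_step[OF v inv prep])
        then show "runs search_step s' 300 (search_inv (Suc v))"
          by (rule runs_straight[rotated 2]) (simp_all add: search_step_def)
      qed (use prep2 A_pos in \<open>auto simp: prepared_def search_step_def search_inv_def\<close>)
      then show "runs (Seq (For ''v'' ''A'' search_step)
          (RSet ''value'' (RAdd (RVar ''base'') (RVar ''best'')))) s2 (A * 323 + 100) ?Q"
      proof (rule runs_Seq')
        fix s3 assume "search_inv A s3"
        then have "rcells s3 ''base'' 0 = objective (b_lower I)" "rcells s3 ''b'' 0 \<in> {b_lower I..b_upper I}"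
          "rcells s3 ''best'' 0 = objective (rcells s3 ''b'' 0) - objective (b_lower I)"
          "\<forall>x\<in>{b_lower I..b_upper I}. objective x - objective (b_lower I) \<le> rcells s3 ''best'' 0"
          unfolding search_inv_def posA objective_def by auto
        then show "runs (RSet ''value'' (RAdd (RVar ''base'') (RVar ''best''))) s3 100 ?Q"
          by (intro runs_straight) auto
      qed simp
    qed simp
  qed simp
qed

section \<open>The whole program on the input memory\<close>

lemma holds_input: "holds_instance (input_memory I)"
  by (auto simp: holds_instance_def input_memory_def input_scalar_def input_vector_def a_def l_def u_def)

lemma runs_solver:
  "runs solver (input_memory I) (10000 * (n ^ 4 * A))
    (\<lambda>s. optimal_solution_SP I (rcells s ''b'' 0) (rcells s ''value'' 0))"
proof -
  let ?s = "input_memory I"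
  let ?Q = "\<lambda>s'. rcells s' ''b'' 0 \<in> {b_lower I..b_upper I} \<and>
    rcells s' ''value'' 0 = objective (rcells s' ''b'' 0) \<and>
    (\<forall>x\<in>{b_lower I..b_upper I}. objective x \<le> objective (rcells s' ''b'' 0))"
  \<comment> \<open>Zeros of the input memory serve as initial values: \<open>al\<close> starts at
    \<open>brk 0\<close>, \<open>H\<close> and \<open>P\<close> start clear, and so do the
    accumulators of the search.\<close>
  have zero: "rcells ?s X = (\<lambda>_. 0)" if "X \<notin> fixed_rnames" for X
    using that by (auto simp: input_memory_def fixed_rnames_def)
  have "runs init_sizes ?s (n * 123 + 100) prepared"
    by (rule runs_init_sizes[OF holds_input]) (simp add: input_memory_def)
  then have "runs solver ?s (n * 123 + 100 + (2 * n * (n * (n * (N * 1400))) + (A * 323 + 200))) ?Q"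
    unfolding solver_def
  proof (rule runs_Seq')
    fix s1 assume prep1: "prepared s1" and un1: "unchanged init_sizes ?s s1"
    have zero1: "rcells s1 X = (\<lambda>_. 0)" if "X \<notin> fixed_rnames" for X
      using zero[OF that] un1 by (simp add: unchanged_def)
    have "runs all_intervals s1 (2 * n * (n * (n * (N * 1400)))) (slopes_are jump)"
      by (rule runs_all_intervals[OF prep1]) (simp_all add: zero1 fixed_rnames_def slopes_are_def)
    then show "runs (Seq all_intervals search) s1 (2 * n * (n * (n * (N * 1400))) + (A * 323 + 200)) ?Q"
    proof (rule runs_Seq')
      fix s2 assume H2: "slopes_are jump s2" and un2: "unchanged all_intervals s1 s2"
      have prep2: "prepared s2"
        by (rule prepared_unchanged[OF prep1 un2]) (auto simp: fixed_inames_def fixed_rnames_def)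
      have zero2: "rcells s2 X = (\<lambda>_. 0)" if "X \<in> {''r'', ''base'', ''cur'', ''best''}" for X
      proof -
        have "X \<notin> rwrites all_intervals" "X \<notin> fixed_rnames"
          using that by (auto simp: fixed_rnames_def)
        with zero1 un2 show ?thesis
          unfolding unchanged_def by metis
      qed
      show "runs search s2 (A * 323 + 200) ?Q"
        by (rule runs_search[OF prep2 H2]) (simp_all add: zero2)
    qed simp
  qed simp
  then show ?thesis
  proof (rule runs_weaken)
    have "2 * n * (n * (n * (N * 1400))) \<le> 2 * n * (n * (n * (2 * (n * A) * 1400)))"
      using N_le by (intro mult_le_mono2 mult_le_mono1)
    also have "\<dots> = 5600 * (n ^ 4 * A)"
      by (simp add: power4_eq_xxxx)
    finally have 1: "2 * n * (n * (n * (N * 1400))) \<le> 5600 * (n ^ 4 * A)" .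
    have "1 \<le> n ^ 4"
      using n_pos by simp
    then have 2: "A \<le> n ^ 4 * A"
      by simp
    \<comment> \<open>5600 = 2 * 2 * 1400, one factor 2 coming from
      \<open>N \<le> 2 * (n * A)\<close>. The remaining terms add at most 123 + 100 + 323 + 200
      multiples of \<open>n ^ 4 * A\<close>, well within 10000.\<close>
    show "n * 123 + 100 + (2 * n * (n * (n * (N * 1400))) + (A * 323 + 200)) \<le> 10000 * (n ^ 4 * A)"
      using 1 2 A_ge_n A_pos by linarith
    fix s' assume "?Q s'"
    then show "optimal_solution_SP I (rcells s' ''b'' 0) (rcells s' ''value'' 0)"
      by (auto simp: optimal_solution_SP_def leader_objective_eq)
  qed
qed

end

theorem theorem7:
  shows "\<exists>(p :: com) (C :: nat). solves_SP_within p (\<lambda>I. C * (items I ^ 4 * total_size I))"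
proof -
  have "solves_SP_within solver (\<lambda>I. 10000 * (items I ^ 4 * total_size I))"
    unfolding solves_SP_within_def
  proof (intro allI impI)
    fix I assume "valid_instance I"
    then interpret valid_SP I
      by unfold_locales
    show "\<exists>t s. exec solver (input_memory I) t s \<and> t \<le> 10000 * (items I ^ 4 * total_size I) \<and>
        optimal_solution_SP I (rcells s ''b'' 0) (rcells s ''value'' 0)"
      using runs_solver unfolding runs_def .
  qed
  then show ?thesis
    by blast
qed

end
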